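(* Let $T$ be a decomposable tournament with at least $9$ vertices. Then $T$ is $\{-3\}$-self dual if and only if $T$ is either transitive or almost transitive.
   Context: All tournaments are finite: a tournament $T=(V,A)$ consists of a finite vertex set $V$ and a set $A$ of ordered pairs of distinct vertices such that for all $x\neq y$ in $V$, exactly one of $(x,y),(y,x)$ is in $A$. For $X\subseteq V$, $T[X]$ is the induced subtournament on $X$. The dual $T^{\ast}$ of $T$ is obtained by reversing all arcs; $T$ is self dual if $T$ is isomorphic to $T^{\ast}$. For a non-negative integer $k$, $T$ is $\{-k\}$-self dual if for every set $X\subseteq V$ with $|X|=k$, the subtournament $T[V\setminus X]$ is self dual. A subset $I\subseteq V$ is an interval of $T$ if every $x\in V\setminus I$ either dominates all elements of $I$ or is dominated by all elements of $I$ (where $x$ dominates $y$ if $(x,y)\in A$). The sets $\emptyset$, $V$ and $\{x\}$ ($x\in V$) are the trivial intervals. $T$ is indecomposable if all its intervals are trivial, and decomposable otherwise. $T$ is transitive if $(x,y)\in A$ and $(y,z)\in A$ imply $(x,z)\in A$ (i.e. $T$ is a linear order). An almost transitive tournament is a tournament obtained from a transitive tournament with at least three vertices by reversing the arc formed by its two extremal vertices (the minimum and the maximum). *)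

theory Defs
  imports "Graph_Theory.Pair_Digraph" "Graph_Theory.Digraph_Isomorphism"
begin

text \<open>The locale \<open>pair_digraph\<close> describes a finite loop-free digraph \<open>(V, A)\<close> whose arcs are
  pairs of vertices.  The empty tournament is allowed.\<close>

locale tournament = pair_digraph T for T :: "'a pair_pre_digraph" +
  assumes exactly_one_arc:
    "\<lbrakk>x \<in> pverts T; y \<in> pverts T; x \<noteq> y\<rbrakk> \<Longrightarrow> ((x, y) \<in> parcs T) \<noteq> ((y, x) \<in> parcs T)"

definition induced :: "'a pair_pre_digraph \<Rightarrow> 'a set \<Rightarrow> 'a pair_pre_digraph" where
  "induced T X = \<lparr>pverts = X, parcs = Restr (parcs T) X\<rparr>"

lemma with_proj_induced: "with_proj (induced T X) = with_proj T \<restriction> X"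
  by (auto simp: induced_def with_proj_def induce_subgraph_def)

definition dual :: "'a pair_pre_digraph \<Rightarrow> 'a pair_pre_digraph" where
  "dual T = \<lparr>pverts = pverts T, parcs = (parcs T)\<inverse>\<rparr>"

definition self_dual :: "'a pair_pre_digraph \<Rightarrow> bool" where
  "self_dual T \<longleftrightarrow> digraph_iso (with_proj T) (with_proj (dual T))"

text \<open>On pair digraphs, isomorphism in the library's sense is the usual arc-preserving bijection of vertices.\<close>

lemma digraph_iso_pair:
  "digraph_iso (with_proj G) (with_proj H) \<longleftrightarrow> wf_digraph (with_proj G) \<and>
   (\<exists>f. inj_on f (pverts G) \<and> f ` pverts G = pverts H \<and> parcs H = map_prod f f ` parcs G)" (is "?L = ?R")
proof
  assume ?L
  then obtain h where h: "pre_digraph.digraph_isomorphism (with_proj G) h" and e: "with_proj H = app_iso h (with_proj G)"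
    by (auto simp: digraph_iso_def)
  have e4: "iso_tail h = fst" "iso_head h = snd" "pverts H = iso_verts h ` pverts G" "parcs H = iso_arcs h ` parcs G"
    using e by (auto simp: app_iso_def with_proj_def)
  have "iso_arcs h a = map_prod (iso_verts h) (iso_verts h) a" if "a \<in> parcs G" for a
    using h that e4 by (cases a) (auto simp: pre_digraph.digraph_isomorphism_def prod_eq_iff)
  then show ?R using h e4 by (auto simp: pre_digraph.digraph_isomorphism_def intro!: exI[of _ "iso_verts h"])
next
  assume R: ?R
  then obtain f where f: "inj_on f (pverts G)" "f ` pverts G = pverts H" "parcs H = map_prod f f ` parcs G" by auto
  have w: "wf_digraph (with_proj G)" using R by simp
  have s: "parcs G \<subseteq> pverts G \<times> pverts G" using w by (auto simp: wf_digraph_def)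
  have i: "inj_on (map_prod f f) (parcs G)"
    by (rule inj_on_subset[OF map_prod_inj_on[OF f(1) f(1)] s])
  show ?L unfolding digraph_iso_def
    by (rule exI[of _ "\<lparr>iso_verts = f, iso_arcs = map_prod f f, iso_head = snd, iso_tail = fst\<rparr>"])
      (use f w i in \<open>auto simp: pre_digraph.digraph_isomorphism_def app_iso_def with_proj_def\<close>)
qed

text \<open>\<open>minus_self_dual k T\<close> is the property written \<open>T\<close> is \<open>{-k}\<close>-self dual.\<close>

definition minus_self_dual :: "nat \<Rightarrow> 'a pair_pre_digraph \<Rightarrow> bool" where
  "minus_self_dual k T \<longleftrightarrow>
     (\<forall>X. X \<subseteq> pverts T \<and> card X = k \<longrightarrow> self_dual (induced T (pverts T - X)))"

definition interval_of :: "'a pair_pre_digraph \<Rightarrow> 'a set \<Rightarrow> bool" where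
  "interval_of T I \<longleftrightarrow> I \<subseteq> pverts T \<and>
     (\<forall>x \<in> pverts T - I. (\<forall>y \<in> I. (x, y) \<in> parcs T) \<or> (\<forall>y \<in> I. (y, x) \<in> parcs T))"

definition trivial_interval :: "'a pair_pre_digraph \<Rightarrow> 'a set \<Rightarrow> bool" where
  "trivial_interval T I \<longleftrightarrow> I = {} \<or> I = pverts T \<or> (\<exists>x \<in> pverts T. I = {x})"

definition indecomposable :: "'a pair_pre_digraph \<Rightarrow> bool" where
  "indecomposable T \<longleftrightarrow> (\<forall>I. interval_of T I \<longrightarrow> trivial_interval T I)"

abbreviation decomposable :: "'a pair_pre_digraph \<Rightarrow> bool" where
  "decomposable T \<equiv> \<not> indecomposable T"

definition transitive :: "'a pair_pre_digraph \<Rightarrow> bool" where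
  "transitive T \<longleftrightarrow> trans (parcs T)"

definition reverse_arc :: "'a \<times> 'a \<Rightarrow> 'a pair_pre_digraph \<Rightarrow> 'a pair_pre_digraph" where
  "reverse_arc e T =
     \<lparr>pverts = pverts T, parcs = insert (snd e, fst e) (parcs T - {e})\<rparr>"

text \<open>Below \<open>a\<close> is the minimum and \<open>b\<close> the maximum of the linear order \<open>L\<close>.\<close>

definition almost_transitive :: "'a pair_pre_digraph \<Rightarrow> bool" where
  "almost_transitive T \<longleftrightarrow>
     (\<exists>L a b. tournament L \<and> transitive L \<and> 3 \<le> card (pverts L) \<and>
        a \<in> pverts L \<and> (\<forall>x \<in> pverts L - {a}. (a, x) \<in> parcs L) \<and>
        b \<in> pverts L \<and> (\<forall>x \<in> pverts L - {b}. (x, b) \<in> parcs L) \<and>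
        T = reverse_arc (a, b) L)"

end

theory Submission
  imports Defs
begin

text \<open>
  Two counting arguments drive the proof.  First, if every subtournament obtained by deleting three
  vertices is self dual, then for any three vertices the numbers of \<open>h\<close>-subsets containing them on
  which the tournament is isomorphic to \<open>H\<close>, respectively to the dual of \<open>H\<close>, agree (as long as
  \<open>h + 3 \<le> n\<close>).  Applied to a 3-cycle dominating one or two further vertices, this shows that proper
  intervals are transitive, so that a nontrivial interval contains two twins \<open>x \<rightarrow> y\<close>; that the
  out-neighbours of the twins and their in-neighbours are both transitive; and finally that switching
  at the in-neighbours turns the tournament into a linear order.  Such a tournament is a cyclic
  sequence of an odd number of runs, that is of transitive blocks whose intervals are the only proper
  intervals.

  Second, a duality of a tournament with \<open>N\<close> vertices maps an interval with \<open>p\<close> out-neighbours and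
  \<open>q\<close> in-neighbours to one with \<open>q\<close> and \<open>p\<close>, so the number of intervals of size \<open>j\<close> is even whenever
  \<open>N - j\<close> is odd.  If after two deletions there are runs of sizes \<open>a, b\<close> with \<open>2 \<le> a < j \<le> b\<close> and
  \<open>j\<close> of the parity of \<open>n\<close>, then shortening either run produces two tournaments whose numbers of
  intervals of size \<open>j\<close> differ by one, a contradiction.  A case analysis of the run lengths leaves
  only three runs, two of them singletons, which is the almost transitive case.
\<close>

section \<open>Cyclic sequences of run lengths\<close>

text \<open>The entries of \<open>zs\<close> are the lengths of the runs of a cyclic word (see below), each diminished
  by one, and \<open>C k zs\<close> means that \<open>k\<close> more vertices may be deleted.  Deleting a vertex shortens a
  run or, if it is a run of its own, makes its two neighbours merge.\<close>

locale reduction =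
  fixes C :: "nat \<Rightarrow> nat list \<Rightarrow> bool" and n :: nat
  assumes n9: "9 \<le> n"
    and rot1: "C k (z # zs) \<Longrightarrow> C k (zs @ [z])"
    and trim: "C (Suc k) (p @ Suc x # q) \<Longrightarrow> C k (p @ x # q)"
    and kill: "C (Suc k) (p @ x # 0 # y # q) \<Longrightarrow> C k (p @ (x + y + 1) # q)"
    and odd_length: "C k zs \<Longrightarrow> odd (length zs)"
    and size: "C k zs \<Longrightarrow> sum_list zs + length zs + 3 = n + k"
    and parity: "\<lbrakk>C 0 zs; 3 \<le> length zs; 2 \<le> j; j < sum_list zs + length zs; even (j + n)\<rbrakk>
      \<Longrightarrow> even (\<Sum>z\<leftarrow>zs. z + 2 - j)"
begin

section \<open>Moves on cyclic sequences, and gaps between positive entries\<close>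

lemma rot: "C k (p @ q) \<Longrightarrow> C k (q @ p)"
proof (induction p arbitrary: q)
  case (Cons a p)
  from rot1[of k a "p @ q"] Cons.prems have "C k (p @ (q @ [a]))" by simp
  from Cons.IH[OF this] show ?case by simp
qed simp

lemma trim_hd: "C (Suc k) (Suc x # q) \<Longrightarrow> C k (x # q)"
  using trim[of k "[]"] by simp

lemma trim_nz: "C (Suc k) (p @ x # q) \<Longrightarrow> x \<noteq> 0 \<Longrightarrow> C k (p @ (x - 1) # q)"
  using trim[of k p "x - 1" q] by simp

lemma kill_hd: "C (Suc k) (x # 0 # y # q) \<Longrightarrow> C k ((x + y + 1) # q)"
  using kill[of k "[]"] by simp

text \<open>Take \<open>j = t + 1\<close> in \<open>parity\<close>: an entry \<open>z\<close>, that
  is a run of \<open>z + 1\<close> vertices, contributes \<open>z + 2 - j\<close> intervals of size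
  \<open>j\<close>. Shortening \<open>x\<close> lowers its contribution by one since
  \<open>t \<le> x\<close>, while \<open>y < t\<close> makes the truncated contribution of
  \<open>y\<close> zero before and after shortening. The two sums differ by one and cannot both be
  even.\<close>

lemma pair1:
  assumes "C 1 (x # p @ y # q)" "1 \<le> y" "y < t" "t \<le> x" "odd (t + n)"
  shows False
proof -
  define f where "f z = z + 2 - (t + 1)" for z :: nat
  have w1: "C 0 ((x - 1) # p @ y # q)"
    using trim_hd[of 0 "x - 1" "p @ y # q"] assms by simp
  have w2: "C 0 (x # p @ (y - 1) # q)"
    using trim[of 0 "x # p" "y - 1" q] assms by simp
  \<comment> \<open>The two named entries alone would give an even length.\<close>
  have l: "3 \<le> length (x # p @ y # q)"
    using odd_length[OF assms(1)] by (cases "length p + length q") auto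
  have "even (\<Sum>z\<leftarrow>(x - 1) # p @ y # q. f z)"
    unfolding f_def using assms l by (intro parity[OF w1]) auto
  moreover have "even (\<Sum>z\<leftarrow>x # p @ (y - 1) # q. f z)"
    unfolding f_def using assms l by (intro parity[OF w2]) auto
  moreover have "f x = Suc (f (x - 1))" "f (y - 1) = f y"
    using assms by (auto simp: f_def)
  ultimately have "even (f (x - 1) + (sum_list (map f p) + f y + sum_list (map f q)))"
    "even (Suc (f (x - 1)) + (sum_list (map f p) + f y + sum_list (map f q)))"
    by (simp_all only: list.map map_append sum_list.Cons sum_list_append add.assoc)
  then show False by presburger
qed

text \<open>Both \<open>y + 1\<close> and \<open>y + 2\<close> are admissible thresholds, and one of
  them has the parity that \<open>pair1\<close> requires.\<close>

lemma gap1: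
  assumes "C 1 (x # p @ y # q)" "1 \<le> y" "y + 2 \<le> x"
  shows False
  using pair1[OF assms(1,2), of "y + 1"] pair1[OF assms(1,2), of "y + 2"] assms(3) by fastforce

text \<open>A gap between two positive entries survives a suitable move as long as enough vertices are
  left, so it is as good with several moves left as with one.\<close>

lemma gap:
  assumes "C (Suc k) (x # p @ y # q)" "1 \<le> y" "y + 2 \<le> x"
  shows False
  using assms
proof (induction k arbitrary: x p y q)
  case 0
  then show ?case using gap1 by auto
next
  case (Suc k)
  note C = Suc.prems(1)
  \<comment> \<open>The first four cases offer a trim that keeps the gap. In the last one the
    entries 3 and 1 are surrounded by zeros only; deleting a zero next to \<open>x\<close> merges a
    further zero into \<open>x\<close> and widens the gap.\<close>
  consider (p) w where "w \<in> set p" "w \<noteq> 0" | (q) w where "w \<in> set q" "w \<noteq> 0"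
    | (x) "y + 3 \<le> x" | (y) "2 \<le> y"
    | (z) "p = replicate (length p) 0" "q = replicate (length q) 0" "y = 1" "x = 3"
  proof -
    have "p = replicate (length p) 0" if "\<forall>w\<in>set p. w = 0" for p :: "nat list"
      using that by (simp add: replicate_eqI)
    moreover have "y + 3 \<le> x \<or> 2 \<le> y \<or> (y = 1 \<and> x = 3)" using Suc.prems(2,3) by linarith
    ultimately show ?thesis using that by blast
  qed
  then show False
  proof cases
    case p
    then obtain p1 p2 where pp: "p = p1 @ w # p2" by (meson split_list)
    have "C (Suc k) (x # (p1 @ (w - 1) # p2) @ y # q)"
      using trim_nz[of "Suc k" "x # p1" w "p2 @ y # q"] C pp p by simp
    from Suc.IH[OF this] show ?thesis using Suc.prems by simp
  next
    case q
    then obtain p1 p2 where pp: "q = p1 @ w # p2" by (meson split_list)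
    have "C (Suc k) (x # p @ y # (p1 @ (w - 1) # p2))"
      using trim_nz[of "Suc k" "x # p @ y # p1" w "p2"] C pp q by simp
    from Suc.IH[OF this] show ?thesis using Suc.prems by simp
  next
    case x
    have "C (Suc k) ((x - 1) # p @ y # q)"
      using trim_nz[of "Suc k" "[]" x] C x by simp
    from Suc.IH[OF this] show ?thesis using Suc.prems x by linarith
  next
    case y
    have "C (Suc k) (x # p @ (y - 1) # q)"
      using trim_nz[of "Suc k" "x # p" y q] C y by simp
    from Suc.IH[OF this] show ?thesis using Suc.prems y by linarith
  next
    case z
    have [simp]: "sum_list p = 0" "sum_list q = 0" using z(1,2) by (metis sum_list_replicate mult_0_right)+
    \<comment> \<open>Since \<open>n \<ge> 9\<close> and at least two moves remain, there are enough
      zeros for one side of the cycle to contain two adjacent ones.\<close>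
    have "length p + length q \<ge> 2" using size[OF C] n9 z by simp
    moreover have "odd (length p + length q)" using odd_length[OF C] by simp
    ultimately have "2 \<le> length p \<or> 2 \<le> length q" by presburger
    then show ?thesis
    proof
      assume "2 \<le> length p"
      then obtain r where r: "p = 0 # 0 # r"
        using z(1) by (metis Suc_le_D numeral_2_eq_2 replicate_Suc Suc_le_mono)
      have "C (Suc k) ((x + 0 + 1) # r @ y # q)"
        using kill_hd[of "Suc k" x 0 "r @ y # q"] C r by simp
      from Suc.IH[OF this] show ?thesis using Suc.prems by simp
    next
      assume "2 \<le> length q"
      then obtain c where c: "length q = c + 2" by (metis le_Suc_ex add.commute)
      have q: "q = replicate c 0 @ [0, 0]"
        using z(2) unfolding c replicate_add by (simp add: numeral_2_eq_2)
      have "C (Suc (Suc k)) ([0, 0] @ (x # p @ y # replicate c 0))"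
        using rot[of "Suc (Suc k)" "x # p @ y # replicate c 0" "[0,0]"] C q by simp
      from kill_hd[of "Suc k" 0 x "p @ y # replicate c 0"] this
      have "C (Suc k) ((x + 1) # p @ y # replicate c 0)" by simp
      from Suc.IH[OF this] show ?thesis using Suc.prems by simp
    qed
  qed
qed

lemma gap_set:
  assumes "C (Suc k) (x # q)" "y \<in> set q" "1 \<le> y" "y + 2 \<le> x"
  shows False
  using gap[of k x _ y] assms by (metis split_list)

text \<open>Only \<open>x = 3\<close> and \<open>y = 2\<close> are not yet two apart; one of the two
  moves turns them into 3 and 1.\<close>

lemma three2:
  assumes "C 2 (x # q)" "y \<in> set q" "1 \<le> y" "y \<le> 2" "3 \<le> x"
  shows False
proof (cases "y + 2 \<le> x")
  case True
  then show ?thesis using gap_set[of 1 x q y] assms by (simp add: numeral_2_eq_2)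
next
  case False
  then have "y = 2" "x = 3" using assms by auto
  obtain a b where "q = a @ y # b" using assms(2) by (meson split_list)
  then have "C (Suc 0) (x # a @ (y - 1) # b)"
    using trim_nz[of 1 "x # a" y b] assms by (simp add: numeral_2_eq_2)
  from gap[OF this] show ?thesis using \<open>y = 2\<close> \<open>x = 3\<close> by simp
qed

text \<open>If \<open>x \<ge> 3\<close>, then shortening \<open>y\<close> at most twice, keeping it
  positive, brings it at least two below \<open>x\<close>, and a move is left to exploit this
  gap.\<close>

lemma entries_le_2:
  assumes "C 3 (x # q)" "y \<in> set q" "1 \<le> y" "y \<le> x"
  shows "x \<le> 2"
proof (rule ccontr)
  assume x: "\<not> x \<le> 2"
  obtain a b where q: "q = a @ y # b" using assms(2) by (meson split_list)
  have t1: "C 2 (x # a @ (y - 1) # b)"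
    using trim_nz[of 2 "x # a" y b] assms q by (simp add: numeral_3_eq_3 numeral_2_eq_2)
  show False
  proof (cases "3 \<le> y")
    case True
    have "C 1 (x # a @ (y - 1 - 1) # b)"
      using trim_nz[of 1 "x # a" "y - 1" b] t1 True by (simp add: numeral_2_eq_2)
    from gap1[OF this] show False using True assms by linarith
  next
    case False
    show False
    proof (cases "y = 2 \<and> x = 3")
      case True
      then show False using gap[of 1 x a "y - 1" b] t1 by (simp add: numeral_2_eq_2)
    next
      case f: False
      have "y + 2 \<le> x" using f False x assms by linarith
      then show False using gap_set[of 2 x q y] assms by (simp add: numeral_3_eq_3)
    qed
  qed
qed


section \<open>Sequences with several positive entries, all at most two\<close>

definition nz :: "nat list \<Rightarrow> nat" where
  "nz zs = length (filter (\<lambda>z. z \<noteq> 0) zs)"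

text \<open>What \<open>entries_le_2\<close> leaves open when at least two entries are positive;
  \<open>not_small\<close> refutes it.\<close>

definition small :: "nat list \<Rightarrow> bool" where
  "small zs \<longleftrightarrow> C 3 zs \<and> (\<forall>z\<in>set zs. z \<le> 2) \<and> 2 \<le> nz zs"

lemma small_rot: "small (p @ q) \<Longrightarrow> small (q @ p)"
  unfolding small_def nz_def using rot[of 3 p q] by auto

lemma small_C: "small zs \<Longrightarrow> C (Suc 2) zs" "small zs \<Longrightarrow> C (Suc (Suc 1)) zs"
  by (auto simp: small_def numeral_3_eq_3 numeral_2_eq_2)

lemma small_size: "small zs \<Longrightarrow> sum_list zs + length zs = n"
  unfolding small_def using size[of 3 zs] by simp

lemma small_odd: "small zs \<Longrightarrow> odd (length zs)"
  unfolding small_def using odd_length by blast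

lemma small_le: "small zs \<Longrightarrow> z \<in> set zs \<Longrightarrow> z \<le> 2"
  unfolding small_def by blast

text \<open>Walking around the cycle from \<open>a\<close>, the stretch of entries satisfying
  \<open>P\<close> must end before \<open>b\<close>; the rotation starts at the last entry of that
  stretch.\<close>

lemma small_adjacent:
  assumes "small zs" "a \<in> set zs" "P a" "b \<in> set zs" "\<not> P b"
  obtains u v q where "small (u # v # q)" "P u" "\<not> P v" "set (u # v # q) = set zs"
proof -
  obtain p r where zs: "zs = p @ a # r" using assms(2) by (meson split_list)
  have small: "small (a # (r @ p))" using small_rot[of p "a # r"] assms(1) zs by simp
  have b: "b \<in> set (r @ p)" using assms zs by auto
  obtain w where w: "w = r @ p" by blast
  have "dropWhile P w \<noteq> []" using b assms(5) w by (auto simp: dropWhile_eq_Nil_conv)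
  then obtain v q where v: "dropWhile P w = v # q" by (cases "dropWhile P w") auto
  have nv: "\<not> P v" using hd_dropWhile[of P w] v by simp
  obtain t u where t: "a # takeWhile P w = t @ [u]" by (metis rev_exhaust list.distinct(1))
  have "P u"
  proof -
    have "u \<in> set (a # takeWhile P w)" using t by simp
    then show ?thesis using assms(3) by (auto dest: set_takeWhileD)
  qed
  have aw: "a # w = t @ u # v # q"
    using t v takeWhile_dropWhile_id[of P w] by (metis append_Cons append_Nil append_assoc)
  then have "small (t @ (u # v # q))" using small w by simp
  from small_rot[OF this] have "small (u # v # (q @ t))" by simp
  moreover have "set (u # v # (q @ t)) = set zs"
  proof -
    have "set (a # w) = set (t @ u # v # q)" using aw by simp
    then show ?thesis using zs w by auto
  qed
  ultimately show thesis using that \<open>P u\<close> nv by blast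
qed

text \<open>Cyclically the last two zeros stand just before \<open>x\<close>. Deleting the second of
  them merges the first, a run of one vertex, into \<open>x\<close>.\<close>

lemma kill_last2:
  assumes "C (Suc k) (x # p @ replicate t 0)" "2 \<le> t"
  shows "C k ((x + 1) # p @ replicate (t - 2) 0)"
proof -
  have "replicate (t - 2 + 2) (0::nat) = replicate (t - 2) 0 @ replicate 2 0"
    by (rule replicate_add)
  moreover have "t - 2 + 2 = t" using assms(2) by simp
  moreover have "replicate 2 0 = [0, 0 :: nat]" by (simp add: numeral_2_eq_2)
  ultimately have "replicate t (0::nat) = replicate (t - 2) 0 @ [0, 0]" by metis
  then have "C (Suc k) ([0, 0] @ (x # p @ replicate (t - 2) 0))"
    using rot[of "Suc k" "x # p @ replicate (t - 2) 0" "[0, 0]"] assms(1) by simp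
  then show ?thesis using kill_hd[of k 0 x "p @ replicate (t - 2) 0"] by simp
qed

lemma all0: "\<forall>w\<in>set q. w = 0 \<Longrightarrow> q = replicate (length q) (0::nat)"
  by (simp add: replicate_eqI)

lemma sum0: "\<forall>w\<in>set q. w = 0 \<Longrightarrow> sum_list q = (0::nat)"
  by (induction q) auto

text \<open>Otherwise deleting the zero merges its neighbours into an entry at least 3, which
  \<open>three2\<close> forbids alongside another positive entry. So \<open>a\<close> and
  \<open>c\<close> are the only positive entries, and merging zeros into one of them raises it to 3
  while the other stays at most 2.\<close>

lemma zero_neighbours:
  assumes "small (a # 0 # c # q)"
  shows "a + c \<le> 1"
proof (rule ccontr)
  assume ac: "\<not> a + c \<le> 1"
  have le: "a \<le> 2" "c \<le> 2" "\<And>w. w \<in> set q \<Longrightarrow> w \<le> 2" using small_le[OF assms] by auto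
  have k: "C 2 ((a + c + 1) # q)" using kill_hd[of 2 a c q] small_C[OF assms] by simp
  have q0: "\<forall>w\<in>set q. w = 0"
  proof (rule ccontr)
    assume "\<not> (\<forall>w\<in>set q. w = 0)"
    then obtain w where "w \<in> set q" "w \<noteq> 0" by blast
    then show False using three2[OF k, of w] ac le by simp
  qed
  define t where "t = length q"
  have q: "q = replicate t 0" using all0[OF q0] t_def by simp
  have nz: "a \<noteq> 0" "c \<noteq> 0"
    using assms q unfolding small_def nz_def by (auto split: if_splits)
  have size: "a + c + 3 + t = n" using small_size[OF assms] q by (simp add: sum_list_replicate)
  have r: "C (Suc 2) (c # [] @ replicate t 0 @ [a, 0])"
    using rot[of 3 "[a, 0]" "c # q"] small_C[OF assms] q by (simp add: numeral_3_eq_3)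
  have r': "C (Suc 2) (a # [0, c] @ replicate t 0)"
    using small_C[OF assms] q by simp
  have t2: "2 \<le> t" using size n9 le by simp
  then have "t = Suc (Suc (t - 2))" by simp
  then obtain t' where t': "t = Suc (Suc t')" by blast
  have k1: "C 2 ((c + 1) # replicate t' 0 @ [a, 0])"
    using kill_hd[of 2 c 0 "replicate t' 0 @ [a, 0]"] r t' by simp
  consider "c = 2" | "a = 2" | "a = 1" "c = 1" using le nz by linarith
  then show False
  proof cases
    case 1
    then show False using three2[OF k1, of a] le nz by simp
  next
    case 2
    have "C 2 ((a + 1) # [0, c] @ replicate (t - 2) 0)" by (rule kill_last2[OF r' t2])
    from three2[OF this, of c] show False using 2 le nz by simp
  next
    \<comment> \<open>Two merges are needed to raise \<open>c\<close> from 1 to 3; one move remains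
      for the gap to \<open>a\<close>.\<close>
    case 3
    then have "4 \<le> t" using size n9 by simp
    then have "t' = Suc (Suc (t' - 2))" using t' by simp
    then obtain t3 where t3: "t' = Suc (Suc t3)" by blast
    have "C (Suc 1) (2 # 0 # 0 # replicate t3 0 @ [1, 0])" using k1 3 t3 by (simp add: numeral_2_eq_2)
    from kill_hd[OF this] have "C (Suc 0) (3 # replicate t3 0 @ [1, 0])" by (simp add: numeral_3_eq_3)
    from gap_set[OF this, of 1] show False by simp
  qed
qed

lemma before_zero: "small (w # 0 # r) \<Longrightarrow> w \<le> 1"
  using zero_neighbours small_odd by (cases r) fastforce+

text \<open>With at least four zeros, deleting one amid the others creates an entry 1. If
  \<open>x\<close> is below 3, it is raised to 3 by merging zeros into it, which gives an impossible
  pair of entries.\<close>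

lemma single_entry:
  assumes C: "C 3 (x # replicate k 0)" and x: "1 \<le> x" and k: "2 \<le> k"
  shows "k = 2"
proof (rule ccontr)
  assume "k \<noteq> 2"
  have ev: "even k" using odd_length[OF C] by simp
  with \<open>k \<noteq> 2\<close> k have k4: "4 \<le> k" by presburger
  have size: "x + k + 1 = n" using size[OF C] by (simp add: sum_list_replicate)
  define r where "r = k - 3"
  have kr: "k = Suc (Suc (Suc r))" using k4 r_def by simp
  have V: "C 2 (x # [1] @ replicate r 0)"
    using kill[of 2 "[x]" 0 0 "replicate r 0"] C kr by (simp add: numeral_3_eq_3)
  consider "3 \<le> x" | "x = 2" | "x = 1" using x by linarith
  then show False
  proof cases
    case 1
    have "C (Suc 1) (x # [1] @ replicate r 0)" using V by (simp add: numeral_2_eq_2)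
    from gap_set[OF this, of 1] show False using 1 by simp
  next
    case 2
    then have "2 \<le> r" using size n9 ev kr by presburger
    from kill_last2[of 1 x "[1]" r, OF _ this] V
    have "C (Suc 0) (3 # [1] @ replicate (r - 2) 0)" using 2 by (simp add: numeral_2_eq_2 numeral_3_eq_3)
    from gap_set[OF this, of 1] show False by simp
  next
    case 3
    then have "5 \<le> r" using size n9 ev kr by presburger
    from kill_last2[of 1 x "[1]" r] V \<open>5 \<le> r\<close>
    have "C (Suc 0) (2 # [1] @ replicate (r - 2) 0)" using 3 by (simp add: numeral_2_eq_2)
    from kill_last2[OF this] \<open>5 \<le> r\<close>
    have W: "C 0 (3 # [1] @ replicate (r - 2 - 2) 0)" by (simp add: numeral_3_eq_3)
    \<comment> \<open>No move is left for \<open>gap\<close>, but here \<open>n = k + 2\<close> is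
      even, and the entry 3 yields exactly one interval of size 4 while the other entries yield
      none.\<close>
    have "even (\<Sum>z\<leftarrow>(3::nat) # [1] @ replicate (r - 2 - 2) 0. z + 2 - 4)"
      using \<open>5 \<le> r\<close> size 3 ev by (intro parity[OF W]) auto
    then show False by (simp add: sum_list_replicate)
  qed
qed

text \<open>Shortening an entry 1 to 0 and then deleting it merges its two neighbours into an entry
  large enough for a gap. If all entries are 2, then \<open>n\<close> is three times the odd length,
  so \<open>pair1\<close> applies with threshold 2 once two entries have been shortened.\<close>

lemma no_zero:
  assumes small: "small zs" and nz: "0 \<notin> set zs"
  shows False
proof -
  have 12: "z = 1 \<or> z = 2" if "z \<in> set zs" for z
    using small_le[OF small that] nz that by (cases "z = 0") auto
  have l3: "3 \<le> length zs"
  proof -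
    have "2 \<le> length zs" using small length_filter_le[of "\<lambda>z. z \<noteq> 0" zs] unfolding small_def nz_def by linarith
    then show ?thesis using small_odd[OF small] by (cases "length zs = 2") auto
  qed
  then obtain a b c q where zs: "zs = a # b # c # q"
    by (auto simp: numeral_3_eq_3 Suc_le_length_iff)
  consider (mix) "1 \<in> set zs" "2 \<in> set zs" | (one) "\<forall>z\<in>set zs. z = 1" | (two) "\<forall>z\<in>set zs. z = 2"
    using 12 by blast
  then show False
  proof cases
    case mix
    obtain u v q where uv: "small (u # v # q)" "u = 1" "v \<noteq> 1" "set (u # v # q) = set zs"
      using small_adjacent[OF small, of 1 "\<lambda>z. z = 1" 2] mix by auto
    have v: "v = 2" using uv 12 by auto
    have "q \<noteq> []" using small_odd[OF uv(1)] by auto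
    then obtain q' c where q: "q = q' @ [c]" by (metis rev_exhaust)
    have small': "small (c # 1 # 2 # q')" using small_rot[of "1 # 2 # q'" "[c]"] uv q v by simp
    have c: "c = 1 \<or> c = 2" using uv 12 q by auto
    have "q' \<noteq> []" using small_size[OF small'] n9 c by auto
    then obtain w where w: "w \<in> set q'" by (cases q') auto
    have w12: "w = 1 \<or> w = 2" using w uv 12 q by auto
    have "C 2 (c # 0 # 2 # q')" using trim[of 2 "[c]" 0 "2 # q'"] small_C[OF small'] by simp
    then have "C (Suc 1) (c # 0 # 2 # q')" by (simp add: numeral_2_eq_2)
    from kill_hd[OF this] have "C (Suc 0) ((c + 2 + 1) # q')" by simp
    from gap_set[OF this w] w12 c show False by auto
  next
    case one
    then have zs': "zs = replicate (length zs) 1" by (simp add: replicate_eqI)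
    have "sum_list zs = length zs" by (subst zs') (simp add: sum_list_replicate)
    then have "q \<noteq> []" using small_size[OF small] n9 zs by auto
    then obtain w where w: "w \<in> set q" by (cases q) auto
    have "C (Suc 2) ([1] @ Suc 0 # 1 # q)" using small_C[OF small] one zs by simp
    from trim[OF this] have "C (Suc 1) (1 # 0 # 1 # q)" by (simp add: numeral_2_eq_2)
    from kill_hd[OF this] have "C (Suc 0) (3 # q)" by (simp add: numeral_3_eq_3)
    from gap_set[OF this w] one w zs show False by auto
  next
    case two
    then have zs': "zs = replicate (length zs) 2" by (simp add: replicate_eqI)
    have "sum_list zs = 2 * length zs" by (subst zs') (simp add: sum_list_replicate)
    then have odd: "odd (2 + n)" using small_size[OF small] small_odd[OF small] by presburger
    have "C (Suc 2) (Suc 1 # 2 # 2 # q)" using small_C[OF small] two zs by (simp add: numeral_2_eq_2)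
    from trim_hd[OF this] have "C (Suc 1) ([1] @ Suc 1 # 2 # q)" by (simp add: numeral_2_eq_2)
    from trim[OF this] have "C 1 ([1, 1] @ 2 # q)" by simp
    from rot[OF this] have "C 1 (2 # q @ 1 # [1])" by simp
    from pair1[OF this, of 2] odd show False by simp
  qed
qed

text \<open>The last positive entry of \<open>q2\<close> is followed by a zero, either inside
  \<open>q2\<close> or cyclically the leading one, so \<open>before_zero\<close> makes it 1.\<close>

lemma one_in_suffix:
  assumes "small (0 # q1 @ q2)" "w \<in> set q2" "w \<noteq> 0"
  shows "1 \<in> set q2"
proof -
  obtain a u b where q2: "q2 = a @ u # b" "u \<noteq> 0" "\<forall>x\<in>set b. x = 0"
    using split_list_last_prop[of q2 "\<lambda>x. x \<noteq> 0"] assms by auto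
  have "\<exists>r. small (u # 0 # r)"
  proof (cases b)
    case Nil
    then show ?thesis using small_rot[of "0 # q1 @ a" "[u]"] assms q2 by auto
  next
    case (Cons c b')
    then show ?thesis using small_rot[of "0 # q1 @ a" "u # b"] assms q2 by auto
  qed
  then have "u \<le> 1" using before_zero by blast
  then show ?thesis using q2 by auto
qed

text \<open>\<open>zero_neighbours\<close> forces \<open>u = 1\<close> and a second zero before it.
  Following the cycle beyond \<open>u\<close>, any continuation other than 1, 0 allows two moves
  that create an entry at least 3 while some entry 1 survives, so that \<open>gap_set\<close>
  applies with the last move.\<close>

lemma after_zero_run:
  assumes "small (0 # u # q)" "u \<noteq> 0"
  obtains q' where "u = 1" "q = 1 # 0 # q' @ [0]"
proof -
  have "q \<noteq> []" using small_odd[OF assms(1)] by auto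
  then obtain r c where q: "q = r @ [c]" by (metis rev_exhaust)
  have D1: "small (c # 0 # u # r)" using small_rot[of "0 # u # r" "[c]"] assms q by simp
  have u: "u = 1" and c: "c = 0" using zero_neighbours[OF D1] assms by auto
  have small: "small (0 # 0 # 1 # r)" using D1 u c by simp
  have r: "\<exists>w\<in>set r. w \<noteq> 0"
  proof (rule ccontr)
    assume "\<not> (\<exists>w\<in>set r. w \<noteq> 0)"
    then have "filter (\<lambda>z. z \<noteq> 0) r = []" by auto
    then show False using small unfolding small_def nz_def by simp
  qed
  then obtain v s where rs: "r = v # s" by (cases r) auto
  have C3: "C (Suc 2) (0 # 0 # 1 # v # s)" using small_C[OF small] rs by simp
  have one: "1 \<in> set s2" if "s = s1 @ s2" "w \<in> set s2" "w \<noteq> 0" for s1 s2 w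
    using one_in_suffix[of "0 # 1 # v # s1" s2 w] small rs that by simp
  have "v \<le> 2" using small_le[OF small] rs by simp
  then consider "v = 0" | "v = 2" | "v = 1" by linarith
  then have "v = 1 \<and> (\<exists>s'. s = 0 # s')"
  proof cases
    case 1
    with r rs obtain w where w: "w \<in> set s" "w \<noteq> 0" by auto
    then obtain x t where s: "s = x # t" by (cases s) auto
    have "small (1 # 0 # x # t @ [0, 0])" using small_rot[of "[0, 0]" "1 # r"] small rs s 1 by simp
    from zero_neighbours[OF this] have x: "x = 0" by simp
    have "C (Suc 1) (2 # 0 # 0 # t)" using kill_hd[of 2 0 1 "0 # s"] C3 1 s x
      by (simp add: numeral_2_eq_2)
    from kill_hd[OF this] have "C (Suc 0) (3 # t)" by (simp add: numeral_3_eq_3)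
    from gap_set[OF this, of 1] one[of "[0]" t w] w s x show ?thesis by auto
  next
    case 2
    have "1 \<in> set (v # s)"
      using one_in_suffix[of "[0, 1]" r v] small rs 2 by simp
    then have s1: "1 \<in> set s" using 2 by simp
    have "C (Suc 1) ([0] @ 0 # 0 # 2 # s)" using trim[of 2 "[0, 0]" 0 "2 # s"] C3 2
      by (simp add: numeral_2_eq_2)
    from kill[OF this] have "C (Suc 0) ([0] @ (3 # s))" by (simp add: numeral_3_eq_3)
    from rot[OF this] have "C (Suc 0) (3 # s @ [0])" by simp
    from gap_set[OF this, of 1] s1 show ?thesis by auto
  next
    case 3
    have "s \<noteq> []" using small_odd[OF small] rs by auto
    then obtain x t where s: "s = x # t" by (cases s) auto
    have "x = 0"
    proof (rule ccontr)
      assume x: "x \<noteq> 0"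
      have "C (Suc 1) ([0, 0] @ 1 # 0 # x # t)" using trim[of 2 "[0, 0, 1]" 0 "x # t"] C3 3 s
        by (simp add: numeral_2_eq_2)
      from kill[OF this] have "C (Suc 0) ([0, 0] @ ((1 + x + 1) # t))" by simp
      from rot[OF this] have C0: "C (Suc 0) ((1 + x + 1) # t @ [0, 0])" by simp
      have t0: "\<forall>w\<in>set t. w = 0"
      proof (rule ccontr)
        assume "\<not> (\<forall>w\<in>set t. w = 0)"
        then have "1 \<in> set t" using one[of "[x]" t] s by auto
        then show False using gap_set[OF C0, of 1] x by simp
      qed
      define k where "k = length t"
      have t: "t = replicate k 0" using all0[OF t0] k_def by simp
      have x1: "x = 1" using one[of "[]" s x] s x t0 by auto
      have "8 + k = n" using small_size[OF small] rs 3 s t x1 by (simp add: sum_list_replicate)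
      moreover have "even k" using small_odd[OF small] rs 3 s t by simp
      \<comment> \<open>The size gives \<open>k \<ge> 1\<close>, and the odd length excludes
        \<open>k = 1\<close>, so two final zeros can be merged into the front.\<close>
      ultimately have k2: "2 \<le> k" using n9 by presburger
      have "C (Suc 2) (0 # [0, 1, 1, 1] @ replicate k 0)" using C3 3 s t x1 by simp
      from kill_last2[OF this k2] have "C (Suc 1) (1 # 0 # 1 # [1, 1] @ replicate (k - 2) 0)"
        by (simp add: numeral_2_eq_2)
      from kill_hd[OF this] have "C (Suc 0) (3 # [1, 1] @ replicate (k - 2) 0)"
        by (simp add: numeral_3_eq_3)
      from gap_set[OF this, of 1] show False by simp
    qed
    then show ?thesis using 3 s by blast
  qed
  then show thesis using that u q c rs by auto
qed

text \<open>By the previous lemma the positive entries are ones that come in adjacent pairs.\<close>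

lemma even_sum_suffix:
  assumes "small zs" "zs = p @ 0 # s" "hd zs = 0"
  shows "even (sum_list s)"
  using assms(2)
proof (induction "length s" arbitrary: p s rule: less_induct)
  case less
  show ?case
  proof (cases s)
    case (Cons u s')
    show ?thesis
    proof (cases "u = 0")
      case True
      then show ?thesis using less.hyps[of s' "p @ [0]"] less.prems Cons by simp
    next
      case False
      have "small (0 # u # s' @ p)" using small_rot[of p "0 # s"] assms(1) less.prems Cons by simp
      from after_zero_run[OF this False] obtain q' where q: "u = 1" "s' @ p = 1 # 0 # q' @ [0]" .
      \<comment> \<open>A pair of ones cannot wrap around the end of \<open>zs\<close>, because
        \<open>zs\<close> begins with a zero.\<close>
      have "s' \<noteq> []"
      proof
        assume "s' = []"
        then have "p = 1 # 0 # q' @ [0]" using q by simp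
        then show False using assms(3) less.prems by simp
      qed
      then obtain s2 where s2: "s' = 1 # s2" using q by (cases s') auto
      show ?thesis
      proof (cases s2)
        case Nil
        then show ?thesis using Cons q s2 by simp
      next
        case c: (Cons y s3)
        then have "y = 0" using q s2 by simp
        then show ?thesis using less.hyps[of s3 "p @ [0, 1, 1]"] less.prems Cons q s2 c by simp
      qed
    qed
  qed simp
qed

text \<open>The positive entries are ones in adjacent pairs, so the sum is even and, the length
  being odd, \<open>n\<close> is odd. A single pair can be turned into the entries 3 and 1; with a
  further positive entry, one pair is turned into 2 and 1, where \<open>pair1\<close> applies with
  threshold 2.\<close>

lemma not_small: "\<not> small zs"
proof
  assume small: "small zs"
  have z: "0 \<in> set zs" using no_zero[OF small] by blast
  have "filter (\<lambda>z. z \<noteq> 0) zs \<noteq> []" using small unfolding small_def nz_def by auto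
  then obtain w where w: "w \<in> set zs" "w \<noteq> 0" by (auto simp: filter_empty_conv)
  obtain z' u q where D1: "small (z' # u # q)" "z' = 0" "u \<noteq> 0"
    by (rule small_adjacent[OF small z, of "\<lambda>z. z = 0" w]) (use w in auto)
  have D2: "small (0 # u # q)" using D1 by simp
  from after_zero_run[OF D2 D1(3)] obtain r where r: "u = 1" "q = 1 # 0 # r @ [0]" .
  have D3: "small (0 # 0 # 1 # 1 # 0 # r)" using small_rot[of "0 # 1 # 1 # 0 # r" "[0]"] D2 r by simp
  have "even (sum_list (0 # 1 # 1 # 0 # r))" using even_sum_suffix[OF D3, of "[]"] by simp
  then have odd: "odd (2 + n)" using small_size[OF D3] small_odd[OF D3] by simp presburger
  show False
  proof (cases "\<forall>w\<in>set r. w = 0")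
    case True
    define k where "k = length r"
    have t: "r = replicate k 0" using all0[OF True] k_def by simp
    have "7 + k = n" using small_size[OF D3] t by (simp add: sum_list_replicate)
    then have "2 \<le> k" using n9 by simp
    have "C (Suc 2) (0 # [0, 1, 1, 0] @ replicate k 0)" using small_C[OF D3] t by simp
    from kill_last2[OF this \<open>2 \<le> k\<close>]
    have "C (Suc 1) (1 # 0 # 1 # [1, 0] @ replicate (k - 2) 0)" by (simp add: numeral_2_eq_2)
    from kill_hd[OF this] have "C (Suc 0) (3 # [1, 0] @ replicate (k - 2) 0)"
      by (simp add: numeral_3_eq_3)
    from gap_set[OF this, of 1] show False by simp
  next
    case False
    then have "1 \<in> set r" using one_in_suffix[of "[0, 1, 1, 0]" r] D3 by auto
    then obtain a b where ab: "r = a @ 1 # b" by (meson split_list)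
    have "C (Suc 1) ((2 # [1, 0] @ a) @ Suc 0 # b)"
      using kill_hd[of 2 0 1 "1 # 0 # r"] small_C[OF D3] ab by (simp add: numeral_2_eq_2)
    \<comment> \<open>\<open>pair1\<close> works with exactly one remaining move, so one move is
      spent on a 1 away from the entries 2 and 1.\<close>
    from trim[OF this] have "C 1 (2 # [] @ 1 # (0 # a @ 0 # b))" by simp
    from pair1[OF this, of 2] odd show False by simp
  qed
qed

text \<open>A largest entry is rotated to the front. If it is the only positive one,
  \<open>single_entry\<close> leaves two zeros; otherwise \<open>entries_le_2\<close> makes the
  sequence \<open>small\<close>.\<close>

lemma final_shape:
  assumes "C 3 zs" "0 < sum_list zs" "3 \<le> length zs"
  obtains x where "C 3 [x, 0, 0]"
proof -
  have "zs \<noteq> []" using assms by auto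
  define x where "x = Max (set zs)"
  have x: "x \<in> set zs" "\<And>z. z \<in> set zs \<Longrightarrow> z \<le> x"
    using \<open>zs \<noteq> []\<close> unfolding x_def by auto
  have "x \<noteq> 0" using assms(2) x(2) sum0[of zs] by fastforce
  obtain p r where zs: "zs = p @ x # r" using x(1) by (meson split_list)
  define q where "q = r @ p"
  have C: "C 3 (x # q)" using rot[of 3 p "x # r"] assms(1) zs q_def by simp
  have le: "\<And>z. z \<in> set q \<Longrightarrow> z \<le> x" using x(2) zs q_def by auto
  have l: "2 \<le> length q" using assms(3) zs q_def by simp
  show thesis
  proof (cases "\<forall>w\<in>set q. w = 0")
    case True
    then have "q = replicate (length q) 0" by (rule all0)
    then obtain k where k: "q = replicate k 0" "2 \<le> k" using l by blast
    have "k = 2" using single_entry[of x k] C k \<open>x \<noteq> 0\<close> by simp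
    then show thesis using that C k by (simp add: numeral_2_eq_2)
  next
    case False
    then obtain y where y: "y \<in> set q" "y \<noteq> 0" by blast
    have "x \<le> 2" using entries_le_2[OF C y(1)] y le by simp
    moreover have "filter (\<lambda>z. z \<noteq> 0) q \<noteq> []" using y by (auto simp: filter_empty_conv)
    then have "2 \<le> nz (x # q)" using \<open>x \<noteq> 0\<close> unfolding nz_def by (cases "filter (\<lambda>z. z \<noteq> 0) q") auto
    ultimately have "small (x # q)"
      using C le unfolding small_def by fastforce
    then show thesis using not_small by blast
  qed
qed

end

section \<open>Counting subtournaments\<close>

text \<open>Self duality of the subtournament on \<open>W\<close>, as an arc-reversing permutation
  of \<open>W\<close>. It refers to the full arc relation, so deleting vertices changes only
  \<open>W\<close>.\<close>

definition selfdual_on :: "('a \<times> 'a) set \<Rightarrow> 'a set \<Rightarrow> bool" where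
  "selfdual_on E W \<longleftrightarrow>
     (\<exists>f. bij_betw f W W \<and> (\<forall>u\<in>W. \<forall>v\<in>W. (u, v) \<in> E \<longleftrightarrow> (f v, f u) \<in> E))"

definition interval :: "('a \<times> 'a) set \<Rightarrow> 'a set \<Rightarrow> 'a set \<Rightarrow> bool" where
  "interval E V I \<longleftrightarrow> I \<subseteq> V \<and> (\<forall>x\<in>V - I. (\<forall>y\<in>I. (x, y) \<in> E) \<or> (\<forall>y\<in>I. (y, x) \<in> E))"

text \<open>Double counting, by downward induction on \<open>card X\<close>: adding up the vanishing
  sums for \<open>insert v X\<close> over all \<open>v \<in> V - X\<close> counts each
  \<open>S\<close> avoiding \<open>X\<close> once for every vertex outside \<open>X\<close> and
  \<open>S\<close>. This number \<open>card V - card X - h\<close> is the same for all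
  \<open>S\<close> and nonzero, so it can be cancelled.\<close>

lemma sum_subsets_avoiding:
  fixes f :: "'a set \<Rightarrow> int"
  assumes fin: "finite V" and h: "h + 3 \<le> card V"
    and zero: "\<And>X. X \<subseteq> V \<Longrightarrow> card X = 3 \<Longrightarrow> sum f {S. S \<subseteq> V - X \<and> card S = h} = 0"
    and X: "X \<subseteq> V" "card X \<le> 3"
  shows "sum f {S. S \<subseteq> V - X \<and> card S = h} = 0"
  using X
proof (induction "3 - card X" arbitrary: X)
  case 0
  then show ?case using zero by simp
next
  case (Suc d)
  define G where "G = {S. S \<subseteq> V - X \<and> card S = h}"
  have finG: "finite G" unfolding G_def using fin by simp
  have finX: "finite X" using Suc.prems fin finite_subset by blast
  have "sum f {S. S \<subseteq> V - insert v X \<and> card S = h} = 0" if v: "v \<in> V - X" for v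
  proof (rule Suc.hyps(1))
    have "card (insert v X) = Suc (card X)" using v finX by simp
    then show "d = 3 - card (insert v X)" "card (insert v X) \<le> 3" using Suc.hyps(2) by linarith+
    show "insert v X \<subseteq> V" using v Suc.prems(1) by blast
  qed
  then have "0 = (\<Sum>v\<in>V - X. sum f {S. S \<subseteq> V - insert v X \<and> card S = h})" by simp
  also have "\<dots> = (\<Sum>v\<in>V - X. \<Sum>S\<in>{S \<in> G. v \<notin> S}. f S)"
    unfolding G_def by (intro sum.cong refl arg_cong[where f = "sum f"]) auto
  also have "\<dots> = (\<Sum>S\<in>G. \<Sum>v\<in>{v \<in> V - X. v \<notin> S}. f S)"
    using fin finG by (intro sum.swap_restrict) auto
  also have "\<dots> = (\<Sum>S\<in>G. int (card V - card X - h) * f S)"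
  proof (intro sum.cong refl)
    fix S assume "S \<in> G"
    then have S: "S \<subseteq> V - X" "card S = h" by (auto simp: G_def)
    have "{v \<in> V - X. v \<notin> S} = V - X - S" by auto
    moreover have "card (V - X - S) = card V - card X - h"
    proof -
      have "finite S" using S(1) fin by (meson finite_Diff finite_subset)
      then have "card (V - X - S) = card (V - X) - card S" using S(1) by (rule card_Diff_subset)
      then show ?thesis using S(2) card_Diff_subset[OF finX Suc.prems(1)] by simp
    qed
    ultimately show "(\<Sum>v\<in>{v \<in> V - X. v \<notin> S}. f S) = int (card V - card X - h) * f S" by simp
  qed
  also have "\<dots> = int (card V - card X - h) * sum f G" by (simp add: sum_distrib_left)
  finally have "int (card V - card X - h) * sum f G = 0" by simp
  moreover have "card V - card X - h \<noteq> 0" using h Suc.hyps(2) by linarith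
  ultimately show ?case unfolding G_def by simp
qed

text \<open>Inclusion-exclusion, one vertex of \<open>P\<close> at a time: the sets containing
  \<open>p\<close> are all sets minus those avoiding \<open>p\<close>, and \<open>p\<close> moves
  from \<open>P\<close> to \<open>X\<close>.\<close>

lemma sum_subsets_containing:
  fixes f :: "'a set \<Rightarrow> int"
  assumes fin: "finite V" and h: "h + 3 \<le> card V"
    and zero: "\<And>X. X \<subseteq> V \<Longrightarrow> card X = 3 \<Longrightarrow> sum f {S. S \<subseteq> V - X \<and> card S = h} = 0"
    and P: "finite P" "P \<subseteq> V" "X \<subseteq> V" "P \<inter> X = {}" "card P + card X \<le> 3"
  shows "sum f {S. P \<subseteq> S \<and> S \<subseteq> V - X \<and> card S = h} = 0"
  using P
proof (induction P arbitrary: X rule: finite_induct)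
  case empty
  have "sum f {S. S \<subseteq> V - X \<and> card S = h} = 0"
    using empty by (intro sum_subsets_avoiding[OF fin h zero]) auto
  then show ?case by simp
next
  case (insert p P)
  define G where "G X = {S. P \<subseteq> S \<and> S \<subseteq> V - X \<and> card S = h}" for X
  have finG: "finite (G X)" unfolding G_def using fin by simp
  have finX: "finite X" using insert.prems fin finite_subset by blast
  have "{S. insert p P \<subseteq> S \<and> S \<subseteq> V - X \<and> card S = h} = G X - G (insert p X)"
    using insert unfolding G_def by blast
  moreover have "G (insert p X) \<subseteq> G X" unfolding G_def by blast
  moreover have "sum f (G X) = 0"
    unfolding G_def by (rule insert.IH) (use insert.prems insert.hyps in auto)
  moreover have "sum f (G (insert p X)) = 0"
    unfolding G_def
  proof (rule insert.IH)
    show "P \<subseteq> V" "insert p X \<subseteq> V" "P \<inter> insert p X = {}" using insert.prems insert.hyps by auto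
    show "card P + card (insert p X) \<le> 3" using insert.prems insert.hyps finX by (simp add: card_insert_if)
  qed
  ultimately show ?case using sum_diff[OF finG, of "G (insert p X)" f] by simp
qed

definition cycle3 :: "('a \<times> 'a) set \<Rightarrow> 'a \<Rightarrow> 'a \<Rightarrow> 'a \<Rightarrow> bool" where
  "cycle3 E a b c \<longleftrightarrow> (a, b) \<in> E \<and> (b, c) \<in> E \<and> (c, a) \<in> E"

text \<open>A 3-cycle dominating all other vertices of \<open>S\<close>. It is used on sets of four
  or five vertices; \<open>cone (E\<inverse>)\<close> is the dual configuration, a 3-cycle dominated
  by the rest.\<close>

definition cone :: "('a \<times> 'a) set \<Rightarrow> 'a set \<Rightarrow> bool" where
  "cone E S \<longleftrightarrow> (\<exists>a b c. cycle3 E a b c \<and> {a, b, c} \<subseteq> S \<and>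
     (\<forall>t\<in>S - {a, b, c}. (a, t) \<in> E \<and> (b, t) \<in> E \<and> (c, t) \<in> E))"

text \<open>A cone is described by arcs that are present, so preserving arcs in one direction
  suffices.\<close>

lemma cone_image:
  assumes W: "S \<subseteq> W" "inj_on f W"
    and f: "\<And>u v. u \<in> W \<Longrightarrow> v \<in> W \<Longrightarrow> (u, v) \<in> E \<Longrightarrow> (f u, f v) \<in> F" and c: "cone E S"
  shows "cone F (f ` S)"
proof -
  obtain a b c where abc: "cycle3 E a b c" "{a, b, c} \<subseteq> S"
    "\<forall>t\<in>S - {a, b, c}. (a, t) \<in> E \<and> (b, t) \<in> E \<and> (c, t) \<in> E"
    using c unfolding cone_def by blast
  have fE: "(f u, f v) \<in> F" if "(u, v) \<in> E" "u \<in> S" "v \<in> S" for u v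
    using f[OF _ _ that(1)] that(2,3) W(1) by auto
  have "cycle3 F (f a) (f b) (f c)"
    using abc(1,2) by (auto simp: cycle3_def intro: fE)
  moreover have "{f a, f b, f c} \<subseteq> f ` S" using abc(2) by blast
  moreover have "\<forall>t\<in>f ` S - {f a, f b, f c}. (f a, t) \<in> F \<and> (f b, t) \<in> F \<and> (f c, t) \<in> F"
  proof
    fix t assume "t \<in> f ` S - {f a, f b, f c}"
    then obtain s where s: "t = f s" "s \<in> S" "s \<in> S - {a, b, c}" by auto
    then have "(a, s) \<in> E" "(b, s) \<in> E" "(c, s) \<in> E" using abc(3) by auto
    then show "(f a, t) \<in> F \<and> (f b, t) \<in> F \<and> (f c, t) \<in> F" using s abc(2) fE by auto
  qed
  ultimately show ?thesis unfolding cone_def by (intro exI[of _ "f a"] exI[of _ "f b"] exI[of _ "f c"] conjI)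
qed

text \<open>Let \<open>f\<close> be the difference of the two indicators. A duality of
  \<open>V - X\<close> permutes the \<open>h\<close>-subsets of \<open>V - X\<close> and turns cones
  into dual cones, so \<open>f\<close> sums to zero over them. \<open>sum_subsets_containing\<close>
  transfers this to the sets containing \<open>P\<close>.\<close>

lemma cone_card:
  assumes fin: "finite V" and h: "h + 3 \<le> card V"
    and sd: "\<And>X. X \<subseteq> V \<Longrightarrow> card X = 3 \<Longrightarrow> selfdual_on E (V - X)"
    and P: "P \<subseteq> V" "card P = 3"
  shows "card {S. P \<subseteq> S \<and> S \<subseteq> V \<and> card S = h \<and> cone E S} =
    card {S. P \<subseteq> S \<and> S \<subseteq> V \<and> card S = h \<and> cone (E\<inverse>) S}"
proof -
  define f where "f S = (if cone E S then 1 else 0) - (if cone (E\<inverse>) S then 1 else 0 :: int)" for S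
  have "sum f {S. S \<subseteq> V - X \<and> card S = h} = 0" if X: "X \<subseteq> V" "card X = 3" for X
  proof -
    let ?W = "V - X"
    obtain g where g: "bij_betw g ?W ?W"
      "\<forall>u\<in>?W. \<forall>v\<in>?W. (u, v) \<in> E \<longleftrightarrow> (g v, g u) \<in> E"
      using sd[OF X] unfolding selfdual_on_def by blast
    have inj: "inj_on g ?W" and im: "g ` ?W = ?W" using g(1) by (auto simp: bij_betw_def)
    let ?G = "{S. S \<subseteq> ?W \<and> card S = h}"
    have bij: "bij_betw (image g) ?G ?G"
    proof (rule bij_betw_imageI)
      show inj': "inj_on (image g) ?G"
        using inj_on_image_eq_iff[OF inj] by (intro inj_onI) blast
      have "g ` S \<in> ?G" if S: "S \<in> ?G" for S
      proof -
        have "inj_on g S" using S inj_on_subset[OF inj] by blast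
        then have "card (g ` S) = h" using S card_image by auto
        moreover have "g ` S \<subseteq> ?W" using S im by blast
        ultimately show ?thesis by blast
      qed
      then show "image g ` ?G = ?G"
        using endo_inj_surj[of ?G "image g"] inj' fin by (simp add: image_subset_iff)
    qed
    have eq: "cone E S \<longleftrightarrow> cone (E\<inverse>) (g ` S)" if "S \<in> ?G" for S
    proof
      assume "cone E S"
      then show "cone (E\<inverse>) (g ` S)" using that inj g(2) by (intro cone_image[of S ?W g E "E\<inverse>"]) auto
    next
      assume c: "cone (E\<inverse>) (g ` S)"
      define k where "k = the_inv_into ?W g"
      have k: "k (g u) = u" if "u \<in> ?W" for u unfolding k_def using the_inv_into_f_f[OF inj that] .
      have "k ` (g ` S) = id ` S" unfolding image_image using k that by (intro image_cong) auto
    then have "k ` (g ` S) = S" by simp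
      moreover have "cone E (k ` (g ` S))"
      proof (rule cone_image[of "g ` S" ?W k "E\<inverse>" E])
        show "g ` S \<subseteq> ?W" using that im by blast
        show "inj_on k ?W" unfolding k_def using inj_on_the_inv_into[OF inj] im by simp
        fix u v assume uv: "u \<in> ?W" "v \<in> ?W" "(u, v) \<in> E\<inverse>"
        obtain u' v' where "u = g u'" "v = g v'" "u' \<in> ?W" "v' \<in> ?W" using uv im by (metis imageE)
        then show "(k u, k v) \<in> E" using uv g(2) k by auto
      qed (use c in auto)
      ultimately show "cone E S" by simp
    qed
    have "(\<Sum>S\<in>?G. (if cone E S then 1 else 0 :: int)) =
        (\<Sum>S\<in>?G. (if cone (E\<inverse>) (g ` S) then 1 else 0))"
      using eq by (intro sum.cong) auto
    also have "\<dots> = (\<Sum>S\<in>?G. (if cone (E\<inverse>) S then 1 else 0))"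
      by (rule sum.reindex_bij_betw[OF bij])
    finally show ?thesis unfolding f_def by (simp add: sum_subtractf)
  qed
  then have "sum f {S. P \<subseteq> S \<and> S \<subseteq> V - {} \<and> card S = h} = 0"
    using P finite_subset[OF P(1) fin] by (intro sum_subsets_containing[OF fin h]) auto
  then have "sum f {S. P \<subseteq> S \<and> S \<subseteq> V \<and> card S = h} = 0" by simp
  then have "(\<Sum>S\<in>{S. P \<subseteq> S \<and> S \<subseteq> V \<and> card S = h}. if cone E S then 1 else 0 :: int) =
      (\<Sum>S\<in>{S. P \<subseteq> S \<and> S \<subseteq> V \<and> card S = h}. if cone (E\<inverse>) S then 1 else 0)"
    unfolding f_def by (simp add: sum_subtractf)
  then have "int (card ({S. P \<subseteq> S \<and> S \<subseteq> V \<and> card S = h} \<inter> {S. cone E S})) =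
      int (card ({S. P \<subseteq> S \<and> S \<subseteq> V \<and> card S = h} \<inter> {S. cone (E\<inverse>) S}))"
    using fin by (simp add: sum.If_cases)
  then show ?thesis by (simp add: Int_def conj_assoc)
qed

lemma no_cone:
  assumes "finite V" "h + 3 \<le> card V"
    "\<And>X. X \<subseteq> V \<Longrightarrow> card X = 3 \<Longrightarrow> selfdual_on E (V - X)"
    "P \<subseteq> V" "card P = 3"
    and none: "\<And>S. P \<subseteq> S \<Longrightarrow> S \<subseteq> V \<Longrightarrow> card S = h \<Longrightarrow> \<not> cone (E\<inverse>) S"
    and S: "P \<subseteq> S" "S \<subseteq> V" "card S = h"
  shows "\<not> cone E S"
proof
  assume c: "cone E S"
  have "{S. P \<subseteq> S \<and> S \<subseteq> V \<and> card S = h \<and> cone (E\<inverse>) S} = {}" using none by blast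
  with cone_card[OF assms(1-5)] have "card {S. P \<subseteq> S \<and> S \<subseteq> V \<and> card S = h \<and> cone E S} = 0" by simp
  moreover have "finite {S. P \<subseteq> S \<and> S \<subseteq> V \<and> card S = h \<and> cone E S}"
    using assms(1) by (auto intro: finite_subset[of _ "Pow V"])
  ultimately show False using c S by auto
qed

section \<open>Tournaments as arc relations, and twins in cones\<close>

locale tourn =
  fixes V :: "'a set" and E :: "('a \<times> 'a) set"
  assumes finite_V: "finite V"
    and irrefl: "x \<in> V \<Longrightarrow> (x, x) \<notin> E"
    and total: "x \<in> V \<Longrightarrow> y \<in> V \<Longrightarrow> x \<noteq> y \<Longrightarrow> (x, y) \<in> E \<longleftrightarrow> (y, x) \<notin> E"
begin

lemma asym: "x \<in> V \<Longrightarrow> y \<in> V \<Longrightarrow> (x, y) \<in> E \<Longrightarrow> (y, x) \<notin> E"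
  using total irrefl by blast

lemma arc_cases: "x \<in> V \<Longrightarrow> y \<in> V \<Longrightarrow> x \<noteq> y \<Longrightarrow> (x, y) \<in> E \<or> (y, x) \<in> E"
  using total by blast

text \<open>\<open>E\<close> is not confined to \<open>V\<close>, so subtournaments keep the same
  arc relation.\<close>

lemma subtourn: "W \<subseteq> V \<Longrightarrow> tourn W E"
  using finite_V irrefl total finite_subset by unfold_locales blast+

lemma converse: "tourn V (E\<inverse>)"
  using finite_V irrefl total by unfold_locales blast+

text \<open>A third vertex tells \<open>a\<close> and \<open>v\<close> apart: \<open>c\<close> if
  \<open>v = b\<close>, and \<open>b\<close> if \<open>v = c\<close> or if \<open>v\<close> lies off
  the cycle, where \<open>a\<close> dominates \<open>b\<close> but \<open>b\<close> dominates
  \<open>v\<close>.\<close>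

lemma cone_twins_aux:
  assumes S: "S \<subseteq> V" and abc: "cycle3 E a b c" "{a, b, c} \<subseteq> S"
    "\<forall>t\<in>S - {a, b, c}. (a, t) \<in> E \<and> (b, t) \<in> E \<and> (c, t) \<in> E"
    and v: "v \<in> S" "a \<noteq> v" "\<forall>w\<in>S - {a, v}. (a, w) \<in> E \<longleftrightarrow> (v, w) \<in> E"
  shows False
proof -
  have V: "a \<in> V" "b \<in> V" "c \<in> V" "v \<in> V" using S abc(2) v(1) by auto
  have E: "(a, b) \<in> E" "(b, c) \<in> E" "(c, a) \<in> E" using abc(1) by (auto simp: cycle3_def)
  have d: "a \<noteq> b" "b \<noteq> c" "c \<noteq> a" using E V irrefl by auto
  have n: "(c, b) \<notin> E" "(a, c) \<notin> E" using E V asym by auto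
  consider "v = b" | "v = c" | "v \<in> S - {a, b, c}" using v by auto
  then show False
  proof cases
    case 1
    have "c \<in> S - {a, v}" using 1 d abc(2) by auto
    with v(3) have "(a, c) \<in> E \<longleftrightarrow> (v, c) \<in> E" by simp
    then show False using 1 E n by simp
  next
    case 2
    have "b \<in> S - {a, v}" using 2 d abc(2) by auto
    with v(3) have "(a, b) \<in> E \<longleftrightarrow> (v, b) \<in> E" by simp
    then show False using 2 E n by simp
  next
    case 3
    with abc(3) have "(b, v) \<in> E" by simp
    then have "(v, b) \<notin> E" using asym V by simp
    moreover have "b \<in> S - {a, v}" using 3 d abc(2) by auto
    with v(3) have "(a, b) \<in> E \<longleftrightarrow> (v, b) \<in> E" by simp
    ultimately show False using E by simp
  qed
qed

lemma cone_twins: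
  assumes S: "S \<subseteq> V" and abc: "cycle3 E a b c" "{a, b, c} \<subseteq> S"
    "\<forall>t\<in>S - {a, b, c}. (a, t) \<in> E \<and> (b, t) \<in> E \<and> (c, t) \<in> E"
    and uv: "u \<in> S" "v \<in> S" "u \<noteq> v"
    "\<forall>w\<in>S - {u, v}. (u, w) \<in> E \<longleftrightarrow> (v, w) \<in> E"
  shows "u \<notin> {a, b, c}"
proof
  assume "u \<in> {a, b, c}"
  then consider "u = a" | "u = b" | "u = c" by blast
  then show False
  proof cases
    case 1
    then show False using cone_twins_aux[OF S abc uv(2)] uv(3,4) by simp
  next
    case 2
    have "cycle3 E b c a" "{b, c, a} = {a, b, c}" using abc(1) by (auto simp: cycle3_def)
    then show False using cone_twins_aux[OF S, of b c a v] abc uv 2 by (simp add: insert_commute)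
  next
    case 3
    have "cycle3 E c a b" "{c, a, b} = {a, b, c}" using abc(1) by (auto simp: cycle3_def)
    then show False using cone_twins_aux[OF S, of c a b v] abc uv 3 by (simp add: insert_commute)
  qed
qed

lemma cycle3_card: "cycle3 E a b c \<Longrightarrow> a \<in> V \<Longrightarrow> b \<in> V \<Longrightarrow> c \<in> V \<Longrightarrow> card {a, b, c} = 3"
  using irrefl unfolding cycle3_def by (auto simp: card_insert_if)

text \<open>Twins lie off the 3-cycle by \<open>cone_twins\<close>, but only one of the four
  vertices does.\<close>

lemma cone4_no_twins:
  assumes S: "S \<subseteq> V" "card S = 4" "cone E S" and uv: "u \<in> S" "v \<in> S" "u \<noteq> v"
  shows "\<exists>w\<in>S - {u, v}. (u, w) \<in> E \<longleftrightarrow> (v, w) \<notin> E"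
proof (rule ccontr)
  assume "\<not> ?thesis"
  then have tw: "\<forall>w\<in>S - {u, v}. (u, w) \<in> E \<longleftrightarrow> (v, w) \<in> E" by blast
  then have tw': "\<forall>w\<in>S - {v, u}. (v, w) \<in> E \<longleftrightarrow> (u, w) \<in> E" by blast
  obtain a b c where abc: "cycle3 E a b c" "{a, b, c} \<subseteq> S"
    "\<forall>t\<in>S - {a, b, c}. (a, t) \<in> E \<and> (b, t) \<in> E \<and> (c, t) \<in> E"
    using S(3) unfolding cone_def by blast
  have "u \<notin> {a, b, c}" "v \<notin> {a, b, c}"
    using cone_twins[OF S(1) abc uv tw] cone_twins[OF S(1) abc uv(2,1) _ tw'] uv(3) by auto
  moreover have "card {a, b, c} = 3"
    using cycle3_card[OF abc(1)] abc(2) S(1) by auto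
  then have "card (S - {a, b, c}) = 1" using abc(2) S(2) by (simp add: card_Diff_subset)
  then obtain t where "S - {a, b, c} = {t}" by (meson card_1_singletonE)
  then have "v = t" "u = t" using uv calculation by auto
  then show False using uv(3) by simp
qed

lemma cone_in_nbr:
  assumes "cone E S" "v \<in> S"
  shows "\<exists>u\<in>S. (u, v) \<in> E"
  using assms unfolding cone_def cycle3_def by fast

end

section \<open>Twins in a decomposable tournament\<close>

locale minus3 = tourn +
  assumes card_V: "9 \<le> card V"
    and selfdual: "X \<subseteq> V \<Longrightarrow> card X = 3 \<Longrightarrow> selfdual_on E (V - X)"
begin

lemma converse3: "minus3 V (E\<inverse>)"
proof -
  interpret c: tourn V "E\<inverse>" by (rule converse)
  have "selfdual_on (E\<inverse>) W" if "selfdual_on E W" for W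
    using that unfolding selfdual_on_def converse_iff by (elim exE conjE) (intro exI conjI, assumption, blast)
  then show ?thesis using card_V selfdual by unfold_locales auto
qed

lemmas no_cone' = no_cone[OF finite_V _ selfdual]

text \<open>A 3-cycle in \<open>I\<close> together with \<open>z\<close> is a cone containing
  \<open>a\<close>, \<open>b\<close>, \<open>z\<close>. No dual cone on four vertices contains these
  three: inside \<open>insert z I\<close> nothing is dominated by \<open>z\<close>, and a fourth
  vertex outside makes \<open>a\<close> and \<open>b\<close> twins.\<close>

lemma interval_acyclic:
  assumes I: "interval E V I" "z \<in> V - I" and abc: "a \<in> I" "b \<in> I" "c \<in> I"
    and out: "\<forall>y\<in>I. (y, z) \<in> E"
  shows "\<not> cycle3 E a b c"
proof
  assume cyc: "cycle3 E a b c"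
  have V: "a \<in> V" "b \<in> V" "c \<in> V" "z \<in> V" using I abc unfolding interval_def by auto
  have d: "a \<noteq> b" "b \<noteq> c" "c \<noteq> a" using cyc V irrefl unfolding cycle3_def by blast+
  have z: "z \<noteq> a" "z \<noteq> b" "z \<noteq> c" using I abc by auto
  have "\<not> cone E {a, b, c, z}"
  proof (rule no_cone'[where P = "{a, b, z}" and h = 4])
    fix S assume S: "{a, b, z} \<subseteq> S" "S \<subseteq> V" "card S = 4"
    interpret c: tourn V "E\<inverse>" by (rule converse)
    show "\<not> cone (E\<inverse>) S"
    proof
      assume cS: "cone (E\<inverse>) S"
      show False
      proof (cases "S \<subseteq> insert z I")
        case True
        obtain u where "u \<in> S" "(z, u) \<in> E" using c.cone_in_nbr[OF cS, of z] S by auto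
        then show False using True out V S irrefl asym I by (metis insertE subsetD)
      next
        case False
        then obtain w where w: "w \<in> S" "w \<notin> insert z I" by blast
        have "card {a, b, z, w} = 4" using d z w abc by (auto simp: card_insert_if)
        then have "S = {a, b, z, w}" using S w finite_V
          by (metis card_subset_eq empty_subsetI finite_subset insert_subset)
        moreover have "(a, w) \<in> E\<inverse> \<longleftrightarrow> (b, w) \<in> E\<inverse>"
          using I w S abc asym V unfolding interval_def by blast
        moreover have "(a, z) \<in> E\<inverse> \<longleftrightarrow> (b, z) \<in> E\<inverse>"
          using out abc V asym by blast
        ultimately show False using c.cone4_no_twins[OF S(2,3) cS, of a b] d by blast
      qed
    qed
  qed (use V d z card_V in \<open>auto simp: card_insert_if\<close>)
  moreover have "cone E {a, b, c, z}"
    unfolding cone_def using cyc out abc by (intro exI[of _ a] exI[of _ b] exI[of _ c]) auto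
  ultimately show False by blast
qed

lemma interval_no_cycle:
  assumes I: "interval E V I" "I \<noteq> V" and abc: "a \<in> I" "b \<in> I" "c \<in> I"
  shows "\<not> cycle3 E a b c"
proof -
  obtain z where z: "z \<in> V - I" using I unfolding interval_def by blast
  interpret c: minus3 V "E\<inverse>" by (rule converse3)
  have Ic: "interval (E\<inverse>) V I" using I(1) unfolding interval_def by auto
  show ?thesis
  proof (cases "\<forall>y\<in>I. (y, z) \<in> E")
    case True
    then show ?thesis using interval_acyclic[OF I(1) z abc] by blast
  next
    case False
    then have "\<forall>y\<in>I. (y, z) \<in> E\<inverse>" using I z unfolding interval_def by blast
    then have "\<not> cycle3 (E\<inverse>) c b a" using c.interval_acyclic[OF Ic z abc(3,2,1)] by blast
    then show ?thesis unfolding cycle3_def by auto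
  qed
qed

text \<open>\<open>I\<close> has no 3-cycle, so it is linearly ordered. An arc of \<open>I\<close>
  with the fewest vertices of \<open>I\<close> in between has none, so its ends are consecutive in
  \<open>I\<close>, and vertices outside \<open>I\<close> do not distinguish them.\<close>

lemma twins_exist:
  assumes I: "interval E V I" "I \<noteq> V" and pq: "p \<in> I" "q \<in> I" "p \<noteq> q"
  obtains x y where "x \<in> V" "y \<in> V" "(x, y) \<in> E" "interval E V {x, y}"
proof -
  have IV: "I \<subseteq> V" using I unfolding interval_def by blast
  have fin: "finite I" using IV finite_V finite_subset by blast
  define m where "m e = card {w \<in> I. (fst e, w) \<in> E \<and> (w, snd e) \<in> E}" for e
  define R where "R = E \<inter> I \<times> I"
  have "R \<noteq> {}" using arc_cases[of p q] pq IV unfolding R_def by blast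
  then obtain x y where xy: "(x, y) \<in> R" "\<And>e. e \<in> R \<Longrightarrow> m (x, y) \<le> m e"
    using ex_has_least_nat[of "\<lambda>e. e \<in> R" _ m] by (metis all_not_in_conv surj_pair)
  have xyI: "x \<in> I" "y \<in> I" "(x, y) \<in> E" using xy unfolding R_def by auto
  have nb: "\<not> ((x, w) \<in> E \<and> (w, y) \<in> E)" if w: "w \<in> I" for w
  proof
    assume a: "(x, w) \<in> E \<and> (w, y) \<in> E"
    have "{u \<in> I. (x, u) \<in> E \<and> (u, w) \<in> E} \<subset> {u \<in> I. (x, u) \<in> E \<and> (u, y) \<in> E}"
    proof
      show "{u \<in> I. (x, u) \<in> E \<and> (u, w) \<in> E} \<subseteq> {u \<in> I. (x, u) \<in> E \<and> (u, y) \<in> E}"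
      proof safe
        fix u assume u: "u \<in> I" "(x, u) \<in> E" "(u, w) \<in> E"
        have "u \<noteq> y" using u a asym w IV xyI by blast
        moreover have "(y, u) \<notin> E"
          using interval_no_cycle[OF I u(1) w xyI(2)] u a unfolding cycle3_def by blast
        ultimately show "(u, y) \<in> E" using arc_cases[of u y] u xyI IV by blast
      qed
      show "{u \<in> I. (x, u) \<in> E \<and> (u, w) \<in> E} \<noteq> {u \<in> I. (x, u) \<in> E \<and> (u, y) \<in> E}"
        using a w irrefl IV by blast
    qed
    then have "m (x, w) < m (x, y)" unfolding m_def using fin by (auto intro!: psubset_card_mono)
    moreover have "(x, w) \<in> R" using a w xyI unfolding R_def by blast
    ultimately show False using xy(2) by fastforce
  qed
  have "interval E V {x, y}"
    unfolding interval_def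
  proof (intro conjI ballI)
    show "{x, y} \<subseteq> V" using xyI IV by blast
    fix w assume w: "w \<in> V - {x, y}"
    show "(\<forall>v\<in>{x, y}. (w, v) \<in> E) \<or> (\<forall>v\<in>{x, y}. (v, w) \<in> E)"
    proof (cases "w \<in> I")
      case True
      have "\<not> ((y, w) \<in> E \<and> (w, x) \<in> E)"
        using interval_no_cycle[OF I xyI(1,2) True] xyI(3) unfolding cycle3_def by blast
      then show ?thesis using nb[OF True] arc_cases[of w x] arc_cases[of w y] w xyI IV by blast
    next
      case False
      then show ?thesis using I(1) w xyI unfolding interval_def by blast
    qed
  qed
  then show thesis using that xyI IV by blast
qed

end

section \<open>The neighbourhoods of a pair of twins\<close>

locale twins = minus3 +
  fixes x y
  assumes xV: "x \<in> V" and yV: "y \<in> V" and xy: "(x, y) \<in> E" and twin: "interval E V {x, y}"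
begin

definition Out where "Out = {z \<in> V - {x, y}. (x, z) \<in> E}"
definition In where "In = {z \<in> V - {x, y}. (z, x) \<in> E}"

lemma converse_twins: "twins V (E\<inverse>) y x"
proof -
  interpret c: minus3 V "E\<inverse>" by (rule converse3)
  show ?thesis using xV yV xy twin by unfold_locales (auto simp: interval_def)
qed

lemma neq: "x \<noteq> y" using xy xV irrefl by blast

lemma twin_in: "z \<in> V \<Longrightarrow> z \<noteq> x \<Longrightarrow> z \<noteq> y \<Longrightarrow> (z, x) \<in> E \<longleftrightarrow> (z, y) \<in> E"
  using twin asym xV yV unfolding interval_def by auto

lemma twin_out: "z \<in> V \<Longrightarrow> z \<noteq> x \<Longrightarrow> z \<noteq> y \<Longrightarrow> (x, z) \<in> E \<longleftrightarrow> (y, z) \<in> E"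
  using twin asym xV yV unfolding interval_def by auto

lemma OutD: "z \<in> Out \<Longrightarrow> z \<in> V \<and> z \<noteq> x \<and> z \<noteq> y \<and> (x, z) \<in> E \<and> (y, z) \<in> E"
  using twin_out unfolding Out_def by auto

lemma InD: "z \<in> In \<Longrightarrow> z \<in> V \<and> z \<noteq> x \<and> z \<noteq> y \<and> (z, x) \<in> E \<and> (z, y) \<in> E"
  using twin_in unfolding In_def by auto

lemma V_cases: "z \<in> V \<Longrightarrow> z = x \<or> z = y \<or> z \<in> Out \<or> z \<in> In"
  using arc_cases[of x z] xV unfolding Out_def In_def by blast

text \<open>A 3-cycle in \<open>Out\<close> dominated by the twins is a dual cone on five vertices.
  No cone on five vertices contains \<open>x\<close>, \<open>y\<close> and \<open>a\<close>: the
  twins would lie off its 3-cycle, so \<open>a\<close> would lie on it and dominate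
  \<open>x\<close>.\<close>

lemma Out_no_cycle:
  assumes abc: "a \<in> Out" "b \<in> Out" "c \<in> Out"
  shows "\<not> cycle3 E a b c"
proof
  assume cyc: "cycle3 E a b c"
  interpret c: minus3 V "E\<inverse>" by (rule converse3)
  note A = abc[THEN OutD]
  have d: "a \<noteq> b" "b \<noteq> c" "c \<noteq> a" using cyc A irrefl unfolding cycle3_def by blast+
  have "\<not> cone (E\<inverse>) {x, y, a, b, c}"
  proof (rule c.no_cone'[where P = "{x, y, a}" and h = 5])
    fix S assume S: "{x, y, a} \<subseteq> S" "S \<subseteq> V" "card S = 5"
    show "\<not> cone ((E\<inverse>)\<inverse>) S"
    proof
      assume "cone ((E\<inverse>)\<inverse>) S"
      then obtain p q r where pqr: "cycle3 E p q r" "{p, q, r} \<subseteq> S"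
        "\<forall>t\<in>S - {p, q, r}. (p, t) \<in> E \<and> (q, t) \<in> E \<and> (r, t) \<in> E"
        unfolding cone_def by auto
      have tw: "(x, w) \<in> E \<longleftrightarrow> (y, w) \<in> E" if "w \<in> V - {x, y}" for w
        using V_cases[of w] that OutD InD asym xV yV by blast
      have "x \<notin> {p, q, r}"
        by (rule cone_twins[OF S(2) pqr, of x y]) (use S tw neq in auto)
      moreover have "y \<notin> {p, q, r}"
        by (rule cone_twins[OF S(2) pqr, of y x]) (use S tw neq in auto)
      ultimately have sub: "{x, y} \<subseteq> S - {p, q, r}" using S(1) by simp
      have "p \<in> V" "q \<in> V" "r \<in> V" using pqr(2) S(2) by auto
      then have "card {p, q, r} = 3" by (rule cycle3_card[OF pqr(1)])
      then have c2: "card (S - {p, q, r}) = 2" using pqr(2) S(3) by (simp add: card_Diff_subset)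
      have "finite S" using S(2) finite_V by (rule finite_subset)
      then have "{x, y} = S - {p, q, r}"
        using sub c2 neq by (intro card_subset_eq) auto
      then have "a \<in> {p, q, r}" "x \<in> S - {p, q, r}" using S(1) A by auto
      then have "(a, x) \<in> E" using pqr(3) by auto
      moreover have "(x, a) \<in> E" "a \<in> V" using A by auto
      ultimately show False using asym xV by simp
    qed
  qed (use A xV yV neq d card_V in \<open>auto simp: card_insert_if\<close>)
  moreover have "cone (E\<inverse>) {x, y, a, b, c}"
    unfolding cone_def using cyc A
    by (intro exI[of _ c] exI[of _ b] exI[of _ a]) (auto simp: cycle3_def)
  ultimately show False by blast
qed

lemma In_no_cycle:
  assumes "a \<in> In" "b \<in> In" "c \<in> In"
  shows "\<not> cycle3 E a b c"
proof -
  interpret c: twins V "E\<inverse>" y x by (rule converse_twins)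
  have "In = c.Out" using twin_in unfolding c.Out_def In_def by auto
  then have "\<not> cycle3 (E\<inverse>) c b a" using c.Out_no_cycle assms by blast
  then show ?thesis unfolding cycle3_def by auto
qed

text \<open>Otherwise \<open>b\<close>, \<open>x\<close>, \<open>a\<close> form a 3-cycle dominating
  \<open>a'\<close>. A dual cone on \<open>x\<close>, \<open>a\<close>, \<open>a'\<close> and a
  fourth vertex \<open>w\<close> is impossible: \<open>w = y\<close> is a twin of \<open>x\<close>;
  for \<open>w\<close> in \<open>Out\<close> the 3-cycle avoids \<open>x\<close> and lies in
  \<open>Out\<close>; for \<open>w\<close> in \<open>In\<close> the 3-cycle is
  \<open>{x, a, a'}\<close>, where \<open>x\<close> has no in-neighbour.\<close>

lemma Out_between:
  assumes a: "a \<in> Out" "a' \<in> Out" and b: "b \<in> In" and arcs: "(a, a') \<in> E" "(a, b) \<in> E"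
  shows "(b, a') \<notin> E"
proof
  assume ba: "(b, a') \<in> E"
  note A = a[THEN OutD] and B = InD[OF b]
  have d: "a \<noteq> a'" "a \<noteq> b" "a' \<noteq> b" using arcs ba A B irrefl by blast+
  have "\<not> cone E {x, a, a', b}"
  proof (rule no_cone'[where P = "{x, a, a'}" and h = 4])
    fix S assume S: "{x, a, a'} \<subseteq> S" "S \<subseteq> V" "card S = 4"
    interpret c: tourn V "E\<inverse>" by (rule converse)
    show "\<not> cone (E\<inverse>) S"
    proof
      assume cS: "cone (E\<inverse>) S"
      then obtain p q r where pqr: "cycle3 (E\<inverse>) p q r" "{p, q, r} \<subseteq> S"
        "\<forall>t\<in>S - {p, q, r}. (t, p) \<in> E \<and> (t, q) \<in> E \<and> (t, r) \<in> E"
        unfolding cone_def by auto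
      have "p \<in> V" "q \<in> V" "r \<in> V" using pqr(2) S(2) by auto
      then have dp: "card {p, q, r} = 3" by (rule c.cycle3_card[OF pqr(1)])
      have "card {x, a, a'} = 3" using A d by auto
      then have "card (S - {x, a, a'}) = 1" using S by (simp add: card_Diff_subset)
      then obtain w where "S - {x, a, a'} = {w}" by (meson card_1_singletonE)
      then have w: "S = {x, a, a', w}" "w \<notin> {x, a, a'}" using S(1) by blast+
      then have "w \<in> V" using S(2) by auto
      from V_cases[OF this] w(2) consider "w = y" | "w \<in> Out" | "w \<in> In" by auto
      then show False
      proof cases
        case 1
        then show False using c.cone4_no_twins[OF S(2,3) cS, of x y] w A neq xV yV asym by auto
      next
        case 2
        have no: "(u, x) \<notin> E" if "u \<in> S" for u
        proof (cases "u = x")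
          case False
          then have "u \<in> Out" using that w 2 a by auto
          then show ?thesis using OutD asym xV by simp
        qed (use irrefl xV in simp)
        have "x \<notin> {p, q, r}" using no pqr(1,2) unfolding cycle3_def by auto
        then have "{p, q, r} \<subseteq> Out" using pqr(2) w 2 a by auto
        then have "\<not> cycle3 E r q p" using Out_no_cycle by auto
        then show False using pqr(1) unfolding cycle3_def by auto
      next
        case 3
        note W = InD[OF 3]
        have "card (S - {p, q, r}) = 1" using dp pqr(2) S by (simp add: card_Diff_subset)
        then obtain t where t: "S - {p, q, r} = {t}" by (meson card_1_singletonE)
        then have tS: "\<forall>s\<in>S - {t}. (t, s) \<in> E" using pqr(3) by blast
        \<comment> \<open>\<open>t\<close> dominates the rest of \<open>S\<close>, but
          \<open>w\<close> dominates \<open>x\<close>, and \<open>x\<close> dominates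
          \<open>a\<close> and \<open>a'\<close>.\<close>
        have "t = w"
        proof -
          have n: "(x, w) \<notin> E" "(a, x) \<notin> E" "(a', x) \<notin> E" using W A asym xV by auto
          have "t \<noteq> x" using n(1) tS w by auto
          moreover have "t \<noteq> a" "t \<noteq> a'" using n(2,3) tS w A by auto
          moreover have "t \<in> {x, a, a', w}" using t w(1) by (metis Diff_iff insertI1)
          ultimately show ?thesis by simp
        qed
        have "x \<in> S" "x \<noteq> t" using \<open>t = w\<close> w by auto
        then have xp: "x \<in> {p, q, r}" using t by (metis DiffI singletonD)
        have "t \<notin> {p, q, r}" using t by (metis DiffD2 insertI1)
        then have "{p, q, r} \<subseteq> {x, a, a'}" using pqr(2) w(1) \<open>t = w\<close> by auto
        with xp have "x \<in> {p, q, r}" "{p, q, r} \<subseteq> {x, a, a'}" by auto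
        then have "\<exists>u\<in>{x, a, a'}. (u, x) \<in> E" using pqr(1) unfolding cycle3_def by auto
        moreover have "(a, x) \<notin> E" "(a', x) \<notin> E" "(x, x) \<notin> E" using A asym xV irrefl by auto
        ultimately show False by simp
      qed
    qed
  qed (use A B xV d card_V in \<open>auto simp: card_insert_if\<close>)
  moreover have "cone E {x, a, a', b}"
    unfolding cone_def using A B arcs ba
    by (intro exI[of _ b] exI[of _ x] exI[of _ a]) (auto simp: cycle3_def)
  ultimately show False by blast
qed

lemma In_between:
  assumes b: "b \<in> In" "b' \<in> In" and a: "a \<in> Out" and arcs: "(b, b') \<in> E" "(b, a) \<in> E"
  shows "(a, b') \<notin> E"
proof -
  interpret c: twins V "E\<inverse>" y x by (rule converse_twins)
  have "In = c.Out" "Out = c.In"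
    using twin_in twin_out unfolding c.Out_def c.In_def In_def Out_def by auto
  then show ?thesis using c.Out_between[of b' b a] b a arcs by auto
qed

text \<open>Reversing the arcs between \<open>In\<close> and its complement yields a linear order.\<close>

definition before :: "'a \<Rightarrow> 'a \<Rightarrow> bool" where
  "before u v \<longleftrightarrow> (if u \<in> In \<longleftrightarrow> v \<in> In then (u, v) \<in> E else (v, u) \<in> E)"

text \<open>Otherwise \<open>u\<close>, \<open>v\<close>, \<open>w\<close> form a 3-cycle of the
  switched relation. Depending on how many of them lie in \<open>In\<close>, this contradicts
  \<open>Out_no_cycle\<close>, \<open>Out_between\<close>, \<open>In_between\<close> or
  \<open>In_no_cycle\<close>.\<close>

lemma before_trans:
  assumes V: "u \<in> V" "v \<in> V" "w \<in> V" and uv: "before u v" "before v w"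
  shows "before u w"
proof -
  have neqs: "u \<noteq> v" "v \<noteq> w" using uv irrefl V unfolding before_def by auto
  have uw: "u \<noteq> w"
  proof
    assume "u = w"
    then show False using uv asym[OF V(1,2)] asym[OF V(2,1)] unfolding before_def by (cases "u \<in> In"; cases "v \<in> In") auto
  qed
  have nn: "\<not> before w u"
  proof
    assume wu: "before w u"
    have plus: False if "p \<notin> In" "q \<notin> In" "r \<notin> In" "p \<in> V" "q \<in> V" "r \<in> V" "cycle3 E p q r" for p q r
    proof -
      \<comment> \<open>Outside \<open>In\<close>, the vertex \<open>x\<close> has no in-neighbour
        and \<open>y\<close> has only \<open>x\<close>, so a 3-cycle avoiding \<open>In\<close> lies
        in \<open>Out\<close>.\<close>
      have nx: "p \<noteq> x" if "p \<notin> In" "r \<notin> In" "p \<in> V" "r \<in> V" "(r, p) \<in> E" for p r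
        using V_cases[of r] that OutD xy asym xV yV irrefl by blast
      have ny: "p \<noteq> y" if "r \<notin> In" "r \<in> V" "(r, p) \<in> E" "r \<noteq> x" for p r
        using V_cases[of r] that OutD asym yV irrefl by blast
      have "p \<noteq> x" "q \<noteq> x" "r \<noteq> x" using that nx unfolding cycle3_def by blast+
      moreover from this have "p \<noteq> y" "q \<noteq> y" "r \<noteq> y" using that ny unfolding cycle3_def by blast+
      ultimately have "p \<in> Out" "q \<in> Out" "r \<in> Out" using V_cases that by blast+
      then show False using Out_no_cycle that by blast
    qed
    have two: False if "p \<notin> In" "q \<notin> In" "r \<in> In" "p \<in> V" "q \<in> V"
      "(p, q) \<in> E" "(r, q) \<in> E" "(p, r) \<in> E" for p q r
    proof -
      note R = InD[OF that(3)]
      have "p \<noteq> x" "p \<noteq> y" using that R asym by blast+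
      then have p: "p \<in> Out" using V_cases that by blast
      then have "q \<noteq> x" "q \<noteq> y" using that OutD asym xV yV by blast+
      then have "q \<in> Out" using V_cases that by blast
      then show False using Out_between[OF p] that by blast
    qed
    have one: False if "p \<notin> In" "q \<in> In" "r \<in> In" "p \<in> V"
      "(q, r) \<in> E" "(q, p) \<in> E" "(p, r) \<in> E" for p q r
    proof -
      have "p \<noteq> x" "p \<noteq> y" using that InD asym by blast+
      then have p: "p \<in> Out" using V_cases that by blast
      then show False using In_between[OF that(2,3) p] that by blast
    qed
    have none: False if "p \<in> In" "q \<in> In" "r \<in> In" "cycle3 E p q r" for p q r
      using In_no_cycle that by blast
    consider "u \<in> In" "v \<in> In" "w \<in> In" | "u \<in> In" "v \<in> In" "w \<notin> In"
      | "u \<in> In" "v \<notin> In" "w \<in> In" | "u \<in> In" "v \<notin> In" "w \<notin> In"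
      | "u \<notin> In" "v \<in> In" "w \<in> In" | "u \<notin> In" "v \<in> In" "w \<notin> In"
      | "u \<notin> In" "v \<notin> In" "w \<in> In" | "u \<notin> In" "v \<notin> In" "w \<notin> In" by blast
    then show False
    proof cases
      case 1 then show False using none[of u v w] uv wu unfolding before_def cycle3_def by simp
    next
      case 2 then show False using one[of w u v] uv wu V unfolding before_def by simp
    next
      case 3 then show False using one[of v w u] uv wu V unfolding before_def by simp
    next
      case 4 then show False using two[of v w u] uv wu V unfolding before_def by simp
    next
      case 5 then show False using one[of u v w] uv wu V unfolding before_def by simp
    next
      case 6 then show False using two[of w u v] uv wu V unfolding before_def by simp
    next
      case 7 then show False using two[of u v w] uv wu V unfolding before_def by simp
    next
      case 8 then show False using plus[of u v w] uv wu V unfolding before_def cycle3_def by simp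
    qed
  qed
  have "before u w \<or> before w u" using arc_cases[OF V(1,3) uw]
    by (cases "u \<in> In"; cases "w \<in> In") (auto simp: before_def)
  then show ?thesis using nn by blast
qed

end

section \<open>Runs and intervals\<close>

definition precedes :: "('a \<times> 'a) set \<Rightarrow> 'a \<times> bool \<Rightarrow> 'a \<times> bool \<Rightarrow> bool" where
  "precedes E p q \<longleftrightarrow> (if snd p = snd q then (fst p, fst q) \<in> E else (fst q, fst p) \<in> E)"

fun alternate :: "bool \<Rightarrow> 'a list list \<Rightarrow> ('a \<times> bool) list" where
  "alternate s [] = []"
| "alternate s (B # Bs) = map (\<lambda>v. (v, s)) B @ alternate (\<not> s) Bs"

lemma alternate_append:
  "alternate s (p @ q) = alternate s p @ alternate (if even (length p) then s else \<not> s) q"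
  by (induction p arbitrary: s) auto

lemma map_fst_alternate [simp]: "map fst (alternate s Bs) = concat Bs"
  by (induction Bs arbitrary: s) (auto simp: comp_def)

lemma alternate_flip: "map (map_prod id Not) (alternate s Bs) = alternate (\<not> s) Bs"
  by (induction Bs arbitrary: s) auto

lemma ex_alternate: "\<exists>s Bs. ws = alternate s Bs \<and> [] \<notin> set Bs"
proof (induction ws)
  case Nil
  have "[] = alternate True [] \<and> [] \<notin> set []" by simp
  then show ?case by blast
next
  case (Cons p ws)
  obtain v t where p: "p = (v, t)" by (cases p)
  obtain s Bs where ws: "ws = alternate s Bs" "[] \<notin> set Bs" using Cons.IH by blast
  show ?case
  proof (cases "Bs = []")
    case True
    then have "p # ws = alternate t [[v]] \<and> [] \<notin> set [[v]]" using p ws by simp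
    then show ?thesis by blast
  next
    case False
    then obtain B Cs where B: "Bs = B # Cs" by (cases Bs) auto
    show ?thesis
    proof (cases "s = t")
      case True
      then have "p # ws = alternate t ((v # B) # Cs) \<and> [] \<notin> set ((v # B) # Cs)" using p ws B by auto
      then show ?thesis by blast
    next
      case False
      then have "s = (\<not> t)" by blast
      then have "p # ws = alternate t ([v] # Bs) \<and> [] \<notin> set ([v] # Bs)" using p ws by simp
      then show ?thesis by blast
    qed
  qed
qed

lemma sorted_flip:
  "sorted_wrt (precedes E) (map (map_prod id Not) ws) \<longleftrightarrow> sorted_wrt (precedes E) ws"
proof -
  have "precedes E (map_prod id Not p) (map_prod id Not q) = precedes E p q" for p q
    by (simp add: precedes_def)
  then show ?thesis by (simp add: sorted_wrt_map)
qed

lemma sorted_alternate_flip: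
  "sorted_wrt (precedes E) (alternate (\<not> s) Bs) \<longleftrightarrow> sorted_wrt (precedes E) (alternate s Bs)"
  by (metis sorted_flip alternate_flip)

text \<open>Between a moved and an unmoved letter, both the order and the agreement of signs are
  reversed, so \<open>precedes\<close> still holds.\<close>

lemma sorted_rotate:
  assumes "sorted_wrt (precedes E) (us @ ws)"
  shows "sorted_wrt (precedes E) (map (map_prod id Not) ws @ us)"
  using assms unfolding sorted_wrt_append sorted_flip
  by (auto simp: precedes_def split: if_splits)

text \<open>A word lists the vertices with signs; arcs between equal signs point forward, the others
  backward.  Rotating the word and flipping the signs that wrap around does not change the arcs, so
  the runs of a word with an odd number of runs form a cycle.\<close>

definition runs :: "('a \<times> 'a) set \<Rightarrow> 'a set \<Rightarrow> 'a list list \<Rightarrow> bool" where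
  "runs E V Bs \<longleftrightarrow> sorted_wrt (precedes E) (alternate True Bs) \<and> distinct (concat Bs) \<and>
     set (concat Bs) = V \<and> [] \<notin> set Bs \<and> odd (length Bs)"

text \<open>With an odd number of runs the first and last signs agree, so flipping the moved runs
  makes the signs alternate at the seam. A global flip restores the initial sign.\<close>

lemma runs_rotate:
  assumes "runs E V (p @ q)"
  shows "runs E V (q @ p)"
proof -
  have s: "sorted_wrt (precedes E) (alternate True p @ alternate (even (length p)) q)"
    using assms unfolding runs_def alternate_append by (cases "even (length p)") auto
  have "sorted_wrt (precedes E) (alternate (\<not> even (length p)) q @ alternate True p)"
    using sorted_rotate[OF s] unfolding alternate_flip .
  moreover have "odd (length p + length q)" using assms by (simp add: runs_def)
  ultimately have "sorted_wrt (precedes E) (alternate True (q @ p))"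
    unfolding alternate_append
    by (cases "even (length p)")
      (use sorted_alternate_flip[of E False "q @ p"] in \<open>auto simp: alternate_append\<close>)
  then show ?thesis using assms unfolding runs_def by auto
qed

lemma runs_delete:
  assumes "runs E V (p @ (B @ v # C) # q)" "B @ C \<noteq> []"
  shows "runs E (V - {v}) (p @ (B @ C) # q)"
  using assms unfolding runs_def alternate_append
  by (auto simp: sorted_wrt_append)

text \<open>The two neighbours of a run carry the same sign, so they join once the single vertex
  between them is gone.\<close>

lemma runs_merge:
  assumes "runs E V (p @ B # [v] # C # q)"
  shows "runs E (V - {v}) (p @ (B @ C) # q)"
  using assms unfolding runs_def alternate_append
  by (auto simp: sorted_wrt_append)

text \<open>If the number of blocks is even, the first and last blocks have opposite signs. Rotating
  the last one to the front flips its sign, so the two merge and the number becomes odd.\<close>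

lemma runs_of_word:
  assumes s: "sorted_wrt (precedes E) ws" and d: "distinct (map fst ws)" and ne: "ws \<noteq> []"
  obtains Bs where "runs E (fst ` set ws) Bs"
proof -
  obtain s Bs where ws: "ws = alternate s Bs" "[] \<notin> set Bs" using ex_alternate by blast
  have c: "concat Bs = map fst ws" using ws by simp
  have T: "sorted_wrt (precedes E) (alternate True Bs)"
    using s ws sorted_alternate_flip[of E False Bs] by (cases s) auto
  have dB: "distinct (concat Bs)" "set (concat Bs) = fst ` set ws" using d c by simp_all
  show thesis
  proof (cases "odd (length Bs)")
    case True
    then have "runs E (fst ` set ws) Bs" unfolding runs_def using T dB ws by simp
    then show thesis by (rule that)
  next
    case False
    have "Bs \<noteq> []" using ne ws by auto
    then have "length Bs \<noteq> 0" "length Bs \<noteq> 1" using False by auto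
    then have "2 \<le> length Bs" by linarith
    then obtain A mid Z where Bs: "Bs = A # mid @ [Z]"
      by (cases Bs; cases "tl Bs" rule: rev_cases) auto
    have "sorted_wrt (precedes E) (map (map_prod id Not) (alternate False [Z]) @ alternate True (A # mid))"
    proof (rule sorted_rotate)
      have "alternate True Bs = alternate True (A # mid) @ alternate False [Z]"
        using alternate_append[of True "A # mid" "[Z]"] False Bs by simp
      then show "sorted_wrt (precedes E) (alternate True (A # mid) @ alternate False [Z])" using T by simp
    qed
    then have "sorted_wrt (precedes E) (alternate True ((Z @ A) # mid))"
      unfolding alternate_flip by simp
    then have "runs E (fst ` set ws) ((Z @ A) # mid)" unfolding runs_def using dB ws False Bs by auto
    then show thesis by (rule that)
  qed
qed

section \<open>Intervals of a tournament given by its runs\<close>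

context tourn begin

lemma interval_closed:
  assumes "interval E V J" "u \<in> J" "v \<in> J" "z \<in> V" "(u, z) \<in> E" "(z, v) \<in> E"
  shows "z \<in> J"
proof (rule ccontr)
  assume "z \<notin> J"
  then have "(z, u) \<in> E \<or> (v, z) \<in> E" using assms unfolding interval_def by auto
  moreover have "u \<in> V" "v \<in> V" using assms unfolding interval_def by auto
  ultimately show False using asym assms by blast
qed

lemma run_uniform:
  assumes r: "runs E V Bs" and B: "B \<in> set Bs" and x: "x \<in> V - set B"
  shows "(\<forall>u\<in>set B. (x, u) \<in> E) \<or> (\<forall>u\<in>set B. (u, x) \<in> E)"
proof -
  obtain p q where Bs: "Bs = p @ B # q" using B by (meson split_list)
  have r': "runs E V (B # (q @ p))" using runs_rotate[of E V p "B # q"] r Bs by simp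
  then have "x \<in> set (concat (q @ p))" using x unfolding runs_def by auto
  then have "x \<in> fst ` set (alternate False (q @ p))"
    by (metis map_fst_alternate set_map)
  then obtain t where t: "(x, t) \<in> set (alternate False (q @ p))" by auto
  have "\<forall>u\<in>set B. precedes E (u, True) (x, t)"
    using r' t unfolding runs_def by (auto simp: sorted_wrt_append)
  then show ?thesis by (cases t) (auto simp: precedes_def)
qed

lemma run_sorted:
  assumes r: "runs E V Bs" and B: "B \<in> set Bs"
  shows "sorted_wrt (\<lambda>u v. (u, v) \<in> E) B" "distinct B" "set B \<subseteq> V"
proof -
  obtain p q where Bs: "Bs = p @ B # q" using B by (meson split_list)
  have r': "runs E V (B # (q @ p))" using runs_rotate[of E V p "B # q"] r Bs by simp
  then show "sorted_wrt (\<lambda>u v. (u, v) \<in> E) B" "distinct B" "set B \<subseteq> V"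
    unfolding runs_def by (auto simp: sorted_wrt_append sorted_wrt_map precedes_def)
qed

text \<open>The remaining word \<open>w\<close> has an even number of runs, so its first letter
  \<open>b\<close> is negative and its last letter \<open>a\<close> positive. Then \<open>c\<close>,
  \<open>a\<close>, \<open>b\<close> form a 3-cycle. A vertex of \<open>J\<close> outside
  \<open>B\<close> brings \<open>a\<close> and \<open>b\<close> into \<open>J\<close> by
  \<open>interval_closed\<close>, and every vertex lies between two of \<open>a\<close>,
  \<open>b\<close>, \<open>c\<close>.\<close>

lemma interval_in_run:
  assumes r: "runs E V (B # Bs)" and ne: "Bs \<noteq> []"
    and J: "interval E V J" "c \<in> J" "c \<in> set B" and notB: "\<not> J \<subseteq> set B"
  shows "J = V"
proof -
  define w where "w = alternate False Bs"
  have ev: "even (length Bs)" using r by (simp add: runs_def)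
  obtain B1 mid where B1: "Bs = B1 # mid" using ne by (cases Bs) auto
  obtain mid' Bl where Bl: "Bs = mid' @ [Bl]" using ne by (cases Bs rule: rev_cases) auto
  have "B1 \<in> set Bs" "Bl \<in> set Bs" using B1 by simp (use Bl in simp)
  then have nn: "B1 \<noteq> []" "Bl \<noteq> []" using r unfolding runs_def by auto
  obtain b w' where b: "w = (b, False) # w'" using nn B1 w_def by (cases B1) auto
  obtain a w'' where a: "w = w'' @ [(a, True)]"
  proof -
    have "w = alternate False mid' @ alternate True [Bl]"
      unfolding w_def Bl alternate_append using ev Bl by simp
    then show thesis using that nn by (cases Bl rule: rev_cases) auto
  qed
  have sw: "sorted_wrt (precedes E) w" and
    Bw: "\<And>u v t. u \<in> set B \<Longrightarrow> (v, t) \<in> set w \<Longrightarrow> precedes E (u, True) (v, t)"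
    using r unfolding runs_def w_def by (auto simp: sorted_wrt_append)
  have V: "V = set B \<union> fst ` set w"
  proof -
    have "fst ` set w = set (concat Bs)" unfolding w_def by (metis map_fst_alternate set_map)
    then show ?thesis using r unfolding runs_def by auto
  qed
  have plus: "(u, v) \<in> E" if "u \<in> set B" "(v, True) \<in> set w" for u v
    using Bw[OF that] by (simp add: precedes_def)
  have minus: "(v, u) \<in> E" if "u \<in> set B" "(v, False) \<in> set w" for u v
    using Bw[OF that] by (simp add: precedes_def)
  have first: "(v, b) \<in> E" if "(v, True) \<in> set w" for v
    using sw that unfolding b by (auto simp: precedes_def)
  have last: "(a, v) \<in> E" if "(v, False) \<in> set w" for v
    using sw that unfolding a by (auto simp: precedes_def sorted_wrt_append)
  have "(a, True) \<in> set w" unfolding a by simp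
  moreover have "(b, False) \<in> set w" unfolding b by simp
  ultimately have ab: "(a, True) \<in> set w" "(b, False) \<in> set w" .
  have inV: "v \<in> V" if "(v, t) \<in> set w" for v t using that V by force
  note closed = interval_closed[OF J(1)]
  obtain v t where v: "v \<in> J" "(v, t) \<in> set w"
    using notB J(1) V unfolding interval_def by force
  have "a \<in> J"
  proof (cases t)
    case True
    have "b \<in> J"
      by (rule closed[of v c b]) (use v True first minus[OF J(3)] J ab inV in auto)
    then show ?thesis
      by (intro closed[of c b a]) (use plus[OF J(3)] first J ab inV in auto)
  next
    case False
    then show ?thesis
      by (intro closed[of c v a]) (use v plus[OF J(3)] last J ab inV in auto)
  qed
  then have bJ: "b \<in> J"
    by (intro closed[of a c b]) (use first minus[OF J(3)] J ab inV in auto)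
  have "x \<in> J" if x: "x \<in> V" for x
  proof -
    consider "x \<in> set B" | s where "(x, s) \<in> set w" using x V by force
    then show ?thesis
    proof cases
      case 1
      then show ?thesis
        by (intro closed[of b a x]) (use \<open>a \<in> J\<close> bJ x plus[OF 1] minus[OF 1] ab in auto)
    next
      case 2
      show ?thesis
      proof (cases s)
        case True
        then show ?thesis
          by (intro closed[of c b x]) (use bJ J x 2 plus[OF J(3)] first in auto)
      next
        case False
        then show ?thesis
          by (intro closed[of a c x]) (use \<open>a \<in> J\<close> J x 2 minus[OF J(3)] last in auto)
      qed
    qed
  qed
  then show ?thesis using J(1) unfolding interval_def by blast
qed

lemma interval_subset_run:
  assumes r: "runs E V Bs" and l: "3 \<le> length Bs"
    and J: "interval E V J" "J \<noteq> {}" "J \<noteq> V"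
  obtains B where "B \<in> set Bs" "J \<subseteq> set B"
proof -
  obtain c where c: "c \<in> J" using J by blast
  then have "c \<in> set (concat Bs)" using J r unfolding interval_def runs_def by blast
  then obtain B where B: "B \<in> set Bs" "c \<in> set B" by auto
  obtain p q where Bs: "Bs = p @ B # q" using B(1) by (meson split_list)
  have "runs E V (B # (q @ p))" using runs_rotate[of E V p "B # q"] r Bs by simp
  moreover have "q @ p \<noteq> []" using l Bs by auto
  ultimately have "J \<subseteq> set B" using interval_in_run J(1,3) c B(2) by blast
  then show thesis using that B by blast
qed

text \<open>By \<open>interval_closed\<close> the positions of \<open>J\<close> in the linearly
  ordered run have no holes.\<close>

lemma interval_segment:
  assumes r: "runs E V Bs" and B: "B \<in> set Bs" and J: "interval E V J" "J \<subseteq> set B" "J \<noteq> {}"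
  obtains p where "p + card J \<le> length B" "J = (!) B ` {p..<p + card J}"
proof -
  note Bs = run_sorted[OF r B]
  define P where "P = {p. p < length B \<and> B ! p \<in> J}"
  have fP: "finite P" unfolding P_def by simp
  have JP: "J = (!) B ` P" using J(2) unfolding P_def by (fastforce simp: in_set_conv_nth)
  have "P \<noteq> {}" using JP J(3) by auto
  have inj: "inj_on ((!) B) P" using Bs(2) unfolding P_def by (auto simp: inj_on_def nth_eq_iff_index_eq)
  have cP: "card P = card J" using card_image[OF inj] JP by simp
  define lo hi where "lo = Min P" and "hi = Max P"
  have lh: "lo \<in> P" "hi \<in> P" "\<And>p. p \<in> P \<Longrightarrow> lo \<le> p \<and> p \<le> hi"
    unfolding lo_def hi_def using fP \<open>P \<noteq> {}\<close> by auto
  have conv: "q \<in> P" if q: "lo \<le> q" "q \<le> hi" for q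
  proof (cases "q = lo \<or> q = hi")
    case True
    then show ?thesis using lh by blast
  next
    case False
    then have o: "lo < q" "q < hi" "hi < length B" using q lh unfolding P_def by auto
    then have "(B ! lo, B ! q) \<in> E" "(B ! q, B ! hi) \<in> E" using Bs(1) by (auto simp: sorted_wrt_iff_nth_less)
    moreover have "B ! q \<in> V" using o Bs(3) by (meson nth_mem order.strict_trans subsetD)
    ultimately have "B ! q \<in> J" using interval_closed[OF J(1)] lh unfolding P_def by blast
    then show ?thesis using o unfolding P_def by simp
  qed
  have "P \<subseteq> {lo..hi}" using lh(3) by auto
  moreover have "{lo..hi} \<subseteq> P" using conv by auto
  ultimately have "P = {lo..hi}" by (rule equalityI)
  moreover from this have "card P = Suc hi - lo" by simp
  moreover have "lo \<le> hi" using lh(3)[OF lh(1)] by simp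
  ultimately have *: "P = {lo..<lo + card P}" "lo + card P = Suc hi" by auto
  moreover have "hi < length B" using lh(2) unfolding P_def by simp
  ultimately show thesis using that[of lo] JP cP by simp
qed

lemma segment_interval:
  assumes r: "runs E V Bs" and B: "B \<in> set Bs" and p: "p + j \<le> length B"
  shows "interval E V ((!) B ` {p..<p + j})"
  unfolding interval_def
proof (intro conjI ballI)
  note Bs = run_sorted[OF r B]
  have sub: "(!) B ` {p..<p + j} \<subseteq> set B" using p by auto
  then show "(!) B ` {p..<p + j} \<subseteq> V" using Bs(3) by blast
  fix x assume x: "x \<in> V - (!) B ` {p..<p + j}"
  show "(\<forall>y\<in>(!) B ` {p..<p + j}. (x, y) \<in> E) \<or> (\<forall>y\<in>(!) B ` {p..<p + j}. (y, x) \<in> E)"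
  proof (cases "x \<in> set B")
    case True
    then obtain q where q: "x = B ! q" "q < length B" by (auto simp: in_set_conv_nth)
    then have "q < p \<or> p + j \<le> q" using x by force
    then show ?thesis using Bs(1) q p by (auto simp: sorted_wrt_iff_nth_less)
  next
    case False
    then show ?thesis using run_uniform[OF r B] x sub by blast
  qed
qed

text \<open>An interval of size \<open>j\<close> is determined by its run and its starting position
  there. A run of \<open>z + 1\<close> vertices has \<open>z + 2 - j\<close> such positions, which
  truncates to zero for short runs.\<close>

lemma card_intervals:
  assumes r: "runs E V Bs" and l: "3 \<le> length Bs" and j: "1 \<le> j" "j < card V"
  shows "card {J. interval E V J \<and> card J = j} = (\<Sum>z\<leftarrow>map (\<lambda>B. length B - 1) Bs. z + 2 - j)"
proof -
  define I where "I = (SIGMA i:{..<length Bs}. {p. p + j \<le> length (Bs ! i)})"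
  define g where "g = (\<lambda>(i, p). (!) (Bs ! i) ` {p..<p + j})"
  have dis: "distinct (concat Bs)" and ne: "[] \<notin> set Bs" using r unfolding runs_def by auto
  have cg: "card (g (i, p)) = j" if "(i, p) \<in> I" for i p
  proof -
    have "distinct (Bs ! i)" using that run_sorted(2)[OF r, of "Bs ! i"] unfolding I_def by auto
    then have "inj_on ((!) (Bs ! i)) {p..<p + j}"
      using that unfolding I_def by (auto simp: inj_on_def nth_eq_iff_index_eq)
    then show ?thesis unfolding g_def by (simp add: card_image)
  qed
  have "{J. interval E V J \<and> card J = j} = g ` I"
  proof safe
    fix J assume J: "interval E V J" "j = card J"
    have "J \<noteq> {}" "J \<noteq> V" using J j by auto
    then obtain B where B: "B \<in> set Bs" "J \<subseteq> set B" using interval_subset_run[OF r l J(1)] by blast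
    then obtain p where p: "p + card J \<le> length B" "J = (!) B ` {p..<p + card J}"
      using interval_segment[OF r B(1) J(1) B(2) \<open>J \<noteq> {}\<close>] by blast
    obtain i where "i < length Bs" "B = Bs ! i" using B(1) by (metis in_set_conv_nth)
    then show "J \<in> g ` I" using p J(2) unfolding g_def I_def by (intro image_eqI[of _ _ "(i, p)"]) auto
  next
    fix i p assume ip: "(i, p) \<in> I"
    then show "interval E V (g (i, p))"
      unfolding g_def I_def using segment_interval[OF r, of "Bs ! i" p j] by auto
    show "card (g (i, p)) = j" using cg[OF ip] .
  qed
  moreover have "inj_on g I"
  proof (rule inj_onI, clarify)
    fix i p i' p' assume ip: "(i, p) \<in> I" and ip': "(i', p') \<in> I" and eq: "g (i, p) = g (i', p')"
    have bound: "i < length Bs" "p + j \<le> length (Bs ! i)" "i' < length Bs" "p' + j \<le> length (Bs ! i')"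
      using ip ip' unfolding I_def by auto
    have "Bs ! i ! p \<in> g (i, p)" using j unfolding g_def by auto
    then have "Bs ! i ! p \<in> g (i', p')" using eq by simp
    then have "Bs ! i ! p \<in> set (Bs ! i')" using bound unfolding g_def by auto
    moreover have "Bs ! i ! p \<in> set (Bs ! i)" using bound j by auto
    ultimately have "Bs ! i = Bs ! i'"
      using dis bound unfolding distinct_concat_iff by (meson disjoint_iff nth_mem)
    moreover have "distinct Bs" using dis ne unfolding distinct_concat_iff by simp
    ultimately have i: "i = i'" using bound by (simp add: nth_eq_iff_index_eq)
    have inj: "inj_on ((!) (Bs ! i)) {..<length (Bs ! i)}"
      using run_sorted(2)[OF r, of "Bs ! i"] bound by (auto simp: inj_on_def nth_eq_iff_index_eq)
    have "{p..<p + j} = {p'..<p' + j}"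
      using eq i bound unfolding g_def by (intro inj_on_image_eq_iff[OF inj, THEN iffD1]) auto
    then show "i = i' \<and> p = p'" using i j by (auto simp: atLeastLessThan_eq_iff)
  qed
  ultimately have "card {J. interval E V J \<and> card J = j} = card I" by (simp add: card_image)
  also have "\<dots> = (\<Sum>i<length Bs. card {p. p + j \<le> length (Bs ! i)})"
    unfolding I_def
  proof (rule card_SigmaI)
    have "finite {p. p + j \<le> length (Bs ! i)}" for i
      by (rule finite_subset[of _ "{..length (Bs ! i)}"]) auto
    then show "\<forall>i\<in>{..<length Bs}. finite {p. p + j \<le> length (Bs ! i)}" by blast
  qed simp
  also have "\<dots> = (\<Sum>i<length Bs. (length (Bs ! i) - 1) + 2 - j)"
  proof (intro sum.cong refl)
    fix i assume "i \<in> {..<length Bs}"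
    then have "Bs ! i \<noteq> []" using ne by (metis lessThan_iff nth_mem)
    then have "length (Bs ! i) \<ge> 1" by (simp add: Suc_le_eq)
    have "{p. p + j \<le> length (Bs ! i)} = {..<length (Bs ! i) + 1 - j}" by auto
    then show "card {p. p + j \<le> length (Bs ! i)} = (length (Bs ! i) - 1) + 2 - j"
      using \<open>length (Bs ! i) \<ge> 1\<close> by simp
  qed
  also have "\<dots> = (\<Sum>z\<leftarrow>map (\<lambda>B. length B - 1) Bs. z + 2 - j)"
    by (simp add: sum_list_sum_nth atLeast0LessThan)
  finally show ?thesis .
qed

text \<open>A duality maps intervals with fewer out-neighbours than in-neighbours to intervals with more,
  and the parity assumption excludes equality.\<close>

lemma selfdual_even_intervals:
  assumes sd: "selfdual_on E V" and odd: "odd (card V + j)" and j: "1 \<le> j"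
  shows "even (card {J. interval E V J \<and> card J = j})"
proof -
  obtain f where bij: "bij_betw f V V" and f: "\<And>u v. u \<in> V \<Longrightarrow> v \<in> V \<Longrightarrow> (u, v) \<in> E \<longleftrightarrow> (f v, f u) \<in> E"
    using sd unfolding selfdual_on_def by auto
  have inj: "inj_on f V" and im: "f ` V = V" using bij by (auto simp: bij_betw_def)
  define G where "G = {J. interval E V J \<and> card J = j}"
  define outs where "outs J = {x \<in> V - J. \<forall>y\<in>J. (y, x) \<in> E}" for J
  define ins where "ins J = {x \<in> V - J. \<forall>y\<in>J. (x, y) \<in> E}" for J
  have finG: "finite G" unfolding G_def interval_def
    using finite_V by (auto intro: finite_subset[of _ "Pow V"])
  have fin: "finite (outs J)" "finite (ins J)" for J using finite_V unfolding outs_def ins_def by auto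
  have odd_diff: "card (outs J) \<noteq> card (ins J)" if "J \<in> G" for J
  proof
    assume eq: "card (outs J) = card (ins J)"
    have J: "interval E V J" "card J = j" "J \<subseteq> V" using that unfolding G_def interval_def by auto
    have "J \<noteq> {}" using J j by auto
    then have "outs J \<inter> ins J = {}" unfolding outs_def ins_def using asym J(3) by blast
    then have "card (outs J \<union> ins J) = card (outs J) + card (ins J)"
      by (intro card_Un_disjoint fin)
    moreover have "outs J \<union> ins J = V - J" using J(1) unfolding interval_def outs_def ins_def by blast
    moreover have "card (V - J) + j = card V"
      using J finite_V by (metis card_Diff_subset card_mono finite_subset le_add_diff_inverse2)
    ultimately have "card V + j = 2 * (card (ins J) + j)" using eq by simp
    then show False using odd by simp
  qed
  have im_f: "f ` J \<in> G" "outs (f ` J) = f ` ins J" "ins (f ` J) = f ` outs J" if "J \<in> G" for J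
  proof -
    have J: "interval E V J" "card J = j" "J \<subseteq> V" using that unfolding G_def interval_def by auto
    have diff: "V - f ` J = f ` (V - J)" using im inj_on_image_set_diff[OF inj, of V J] J(3) by simp
    have fJ: "(\<forall>y\<in>f ` J. (y, f z) \<in> E) \<longleftrightarrow> (\<forall>y\<in>J. (z, y) \<in> E)"
      "(\<forall>y\<in>f ` J. (f z, y) \<in> E) \<longleftrightarrow> (\<forall>y\<in>J. (y, z) \<in> E)" if "z \<in> V" for z
      using f[OF that] f[OF _ that] J(3) by (auto simp: subset_iff)
    have "outs (f ` J) = f ` {z \<in> V - J. \<forall>y\<in>f ` J. (y, f z) \<in> E}"
      unfolding outs_def diff by blast
    also have "{z \<in> V - J. \<forall>y\<in>f ` J. (y, f z) \<in> E} = ins J"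
      unfolding ins_def by (intro Collect_cong conj_cong refl fJ(1)) simp
    finally show "outs (f ` J) = f ` ins J" .
    have "ins (f ` J) = f ` {z \<in> V - J. \<forall>y\<in>f ` J. (f z, y) \<in> E}"
      unfolding ins_def diff by blast
    also have "{z \<in> V - J. \<forall>y\<in>f ` J. (f z, y) \<in> E} = outs J"
      unfolding outs_def by (intro Collect_cong conj_cong refl fJ(2)) simp
    finally show "ins (f ` J) = f ` outs J" .
    have "card (f ` J) = j" using card_image[OF inj_on_subset[OF inj J(3)]] J(2) by simp
    moreover have "interval E V (f ` J)"
      unfolding interval_def diff
    proof (intro conjI ballI)
      show "f ` J \<subseteq> V" using im J(3) by blast
      fix x assume "x \<in> f ` (V - J)"
      then obtain z where z: "x = f z" "z \<in> V - J" by blast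
      then have "(\<forall>y\<in>J. (z, y) \<in> E) \<or> (\<forall>y\<in>J. (y, z) \<in> E)" using J(1) unfolding interval_def by blast
      then show "(\<forall>y\<in>f ` J. (x, y) \<in> E) \<or> (\<forall>y\<in>f ` J. (y, x) \<in> E)"
        unfolding z(1) using fJ[of z] z(2) by fast
    qed
    ultimately show "f ` J \<in> G" unfolding G_def by simp
  qed
  have card_f: "card (f ` A) = card A" if "A \<subseteq> V" for A
    using card_image[OF inj_on_subset[OF inj that]] .
  have sub: "outs J \<subseteq> V" "ins J \<subseteq> V" for J unfolding outs_def ins_def by auto
  have injG: "inj_on (image f) H" if "H \<subseteq> G" for H
  proof (rule inj_onI)
    fix J K assume "J \<in> H" "K \<in> H" and eq: "f ` J = f ` K"
    then have "J \<subseteq> V" "K \<subseteq> V" using that unfolding G_def interval_def by auto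
    then show "J = K" using inj_on_image_eq_iff[OF inj] eq by simp
  qed
  define P where "P = {J \<in> G. card (outs J) < card (ins J)}"
  define N where "N = {J \<in> G. card (ins J) < card (outs J)}"
  have "card P \<le> card N"
  proof (rule card_inj_on_le[OF injG])
    show "image f ` P \<subseteq> N" unfolding P_def N_def using im_f card_f sub by auto
  qed (auto simp: P_def N_def finG)
  moreover have "card N \<le> card P"
  proof (rule card_inj_on_le[OF injG])
    show "image f ` N \<subseteq> P" unfolding P_def N_def using im_f card_f sub by auto
  qed (auto simp: P_def N_def finG)
  moreover have "G = P \<union> N" using odd_diff unfolding P_def N_def by (auto simp: nat_neq_iff)
  moreover have "card (P \<union> N) = card P + card N"
    by (rule card_Un_disjoint) (auto simp: P_def N_def finG)
  ultimately show ?thesis unfolding G_def by simp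
qed

end

section \<open>Tournament records and their arc relations\<close>

lemma self_dual_induced:
  assumes W: "W \<subseteq> pverts T"
  shows "self_dual (induced T W) \<longleftrightarrow> selfdual_on (parcs T) W"
proof -
  let ?E = "parcs T" and ?R = "Restr (parcs T) W"
  have wf: "wf_digraph (with_proj (induced T W))"
    by unfold_locales (auto simp: induced_def)
  have sd: "self_dual (induced T W) \<longleftrightarrow>
      (\<exists>f. inj_on f W \<and> f ` W = W \<and> ?R\<inverse> = map_prod f f ` ?R)"
    unfolding self_dual_def digraph_iso_pair using wf by (simp add: induced_def dual_def)
  \<comment> \<open>Injectivity of \<open>f\<close> recovers an arc from its image, so equality of
    the arc sets becomes a condition on pairs of vertices.\<close>
  have "?R\<inverse> = map_prod f f ` ?R \<longleftrightarrow> (\<forall>u\<in>W. \<forall>v\<in>W. (u, v) \<in> ?E \<longleftrightarrow> (f v, f u) \<in> ?E)"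
    if f: "inj_on f W" "f ` W = W" for f
  proof
    assume eq: "?R\<inverse> = map_prod f f ` ?R"
    show "\<forall>u\<in>W. \<forall>v\<in>W. (u, v) \<in> ?E \<longleftrightarrow> (f v, f u) \<in> ?E"
    proof (intro ballI iffI)
      fix u v assume uv: "u \<in> W" "v \<in> W" "(u, v) \<in> ?E"
      then have "(f u, f v) \<in> map_prod f f ` ?R" by (intro image_eqI[of _ _ "(u, v)"]) auto
      then show "(f v, f u) \<in> ?E" unfolding eq[symmetric] by simp
    next
      fix u v assume uv: "u \<in> W" "v \<in> W" "(f v, f u) \<in> ?E"
      then have "(f u, f v) \<in> ?R\<inverse>" using f(2) by auto
      then obtain a b where ab: "f u = f a" "f v = f b" "(a, b) \<in> ?R" unfolding eq by auto
      then have "u = a" "v = b" using uv inj_onD[OF f(1)] by auto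
      then show "(u, v) \<in> ?E" using ab by simp
    qed
  next
    assume h: "\<forall>u\<in>W. \<forall>v\<in>W. (u, v) \<in> ?E \<longleftrightarrow> (f v, f u) \<in> ?E"
    show "?R\<inverse> = map_prod f f ` ?R"
    proof (rule set_eqI, clarify, rule iffI)
      fix a b assume "(a, b) \<in> ?R\<inverse>"
      then have "(b, a) \<in> ?E" "a \<in> f ` W" "b \<in> f ` W" using f(2) by auto
      then obtain u v where uv: "a = f u" "b = f v" "u \<in> W" "v \<in> W" by blast
      then have "(u, v) \<in> ?R" using h \<open>(b, a) \<in> ?E\<close> by simp
      then show "(a, b) \<in> map_prod f f ` ?R" using uv by (intro image_eqI[of _ _ "(u, v)"]) auto
    next
      fix a b assume "(a, b) \<in> map_prod f f ` ?R"
      then obtain u v where uv: "a = f u" "b = f v" "u \<in> W" "v \<in> W" "(u, v) \<in> ?E" by auto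
      then show "(a, b) \<in> ?R\<inverse>" using h f(2) by auto
    qed
  qed
  then show ?thesis unfolding sd selfdual_on_def bij_betw_def by meson
qed

lemma tournament_tourn: "tournament T \<Longrightarrow> tourn (pverts T) (parcs T)"
proof -
  assume "tournament T"
  then interpret tournament T .
  show ?thesis
  proof
    show "finite (pverts T)" by (rule pair_finite_verts)
    show "(x, x) \<notin> parcs T" for x using pair_no_loops[of "(x, x)"] by auto
    show "(x, y) \<in> parcs T \<longleftrightarrow> (y, x) \<notin> parcs T"
      if "x \<in> pverts T" "y \<in> pverts T" "x \<noteq> y" for x y
      using exactly_one_arc[OF that] by blast
  qed
qed

lemma tournament_arcs: "tournament T \<Longrightarrow> parcs T \<subseteq> pverts T \<times> pverts T"
proof -
  assume "tournament T"
  then interpret tournament T .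
  show ?thesis using in_arcsD1 in_arcsD2 by auto
qed

lemma tournamentI:
  assumes "tourn (pverts T) (parcs T)" "parcs T \<subseteq> pverts T \<times> pverts T"
  shows "tournament T"
proof -
  interpret tourn "pverts T" "parcs T" by fact
  have "finite (parcs T)" using assms(2) finite_V by (meson finite_SigmaI finite_subset)
  then show ?thesis
  proof unfold_locales
    fix e assume e: "e \<in> parcs T"
    show "fst e \<in> pverts T" "snd e \<in> pverts T" using e assms(2) by auto
    show "fst e \<noteq> snd e"
    proof
      assume "fst e = snd e"
      then have "(fst e, fst e) \<in> parcs T" using e by (metis prod.collapse)
      then show False using irrefl[of "fst e"] e assms(2) by auto
    qed
  next
    show "((x, y) \<in> parcs T) \<noteq> ((y, x) \<in> parcs T)"
      if "x \<in> pverts T" "y \<in> pverts T" "x \<noteq> y" for x y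
      using total[OF that] by blast
  qed (rule finite_V)
qed

section \<open>Transitive tournaments as sorted lists\<close>

context tourn begin

lemma sorted_list:
  assumes trans: "\<forall>u\<in>V. \<forall>v\<in>V. \<forall>w\<in>V. (u, v) \<in> E \<longrightarrow> (v, w) \<in> E \<longrightarrow> (u, w) \<in> E"
  obtains vs where "distinct vs" "set vs = V" "sorted_wrt (\<lambda>u v. (u, v) \<in> E) vs"
proof -
  have "\<exists>vs. distinct vs \<and> set vs = W \<and> sorted_wrt (\<lambda>u v. (u, v) \<in> E) vs"
    if "finite W" "W \<subseteq> V" for W
    using that
  proof (induction rule: finite_induct)
    case empty
    show ?case by (intro exI[of _ "[]"]) simp
  next
    case (insert x W)
    then obtain vs where vs: "distinct vs" "set vs = W" "sorted_wrt (\<lambda>u v. (u, v) \<in> E) vs" by auto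
    define a where "a = filter (\<lambda>u. (u, x) \<in> E) vs"
    define b where "b = filter (\<lambda>u. (x, u) \<in> E) vs"
    have x: "x \<in> V" "x \<notin> W" "W \<subseteq> V" using insert by auto
    have set: "set (a @ x # b) = insert x W"
      using vs(2) x arc_cases[OF _ x(1)] unfolding a_def b_def by auto
    have dis: "distinct (a @ x # b)"
      using vs(1,2) x asym unfolding a_def b_def by auto
    have "(u, w) \<in> E" if "u \<in> set a" "w \<in> set b" for u w
    proof -
      have "u \<in> V" "(u, x) \<in> E" "w \<in> V" "(x, w) \<in> E"
        using that x(3) vs(2) by (simp_all add: a_def b_def subset_iff)
      then show ?thesis using trans x(1) by blast
    qed
    moreover have "sorted_wrt (\<lambda>u v. (u, v) \<in> E) a" "sorted_wrt (\<lambda>u v. (u, v) \<in> E) b"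
      unfolding a_def b_def using vs(3) by (simp_all add: sorted_wrt_filter)
    ultimately have "sorted_wrt (\<lambda>u v. (u, v) \<in> E) (a @ x # b)"
      unfolding sorted_wrt_append by (auto simp: a_def b_def)
    then show ?case using set dis by (intro exI[of _ "a @ x # b"] conjI)
  qed
  from this[OF finite_V subset_refl] show thesis by (elim exE conjE) (rule that)
qed

lemma sorted_trans:
  assumes s: "sorted_wrt (\<lambda>u v. (u, v) \<in> E) vs" and V: "set vs = V" and E: "E \<subseteq> V \<times> V"
  shows "trans E"
proof (rule transI)
  fix u v w assume uv: "(u, v) \<in> E" "(v, w) \<in> E"
  then have "u \<in> set vs" "v \<in> set vs" "w \<in> set vs" using E V by auto
  then obtain i j k where i: "i < length vs" "u = vs ! i" "j < length vs" "v = vs ! j"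
    "k < length vs" "w = vs ! k" by (metis in_set_conv_nth)
  have le: "p < q" if "p < length vs" "q < length vs" "(vs ! p, vs ! q) \<in> E" for p q
  proof (rule ccontr)
    assume "\<not> p < q"
    then consider "p = q" | "q < p" by linarith
    then show False
    proof cases
      case 1
      then show False using that irrefl V by auto
    next
      case 2
      then have "(vs ! q, vs ! p) \<in> E" using s that(1) by (simp add: sorted_wrt_iff_nth_less)
      then show False using that V asym[of "vs ! p" "vs ! q"] by auto
    qed
  qed
  have "i < j" "j < k" using le uv i by auto
  then show "(u, w) \<in> E" using s i by (simp add: sorted_wrt_iff_nth_less)
qed

text \<open>The vertices are listed in order, and the one at position \<open>i\<close> is sent to
  position \<open>?n - 1 - i\<close>.\<close>

lemma reversal:
  assumes "\<forall>u\<in>V. \<forall>v\<in>V. \<forall>w\<in>V. (u, v) \<in> E \<longrightarrow> (v, w) \<in> E \<longrightarrow> (u, w) \<in> E"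
  shows "selfdual_on E V"
proof -
  obtain vs where vs: "distinct vs" "set vs = V" "sorted_wrt (\<lambda>u v. (u, v) \<in> E) vs"
    using sorted_list[OF assms] by blast
  let ?n = "length vs"
  have less: "(vs ! p, vs ! q) \<in> E \<longleftrightarrow> p < q" if "p < ?n" "q < ?n" for p q
  proof -
    have "(vs ! p, vs ! q) \<in> E" if "p < q" "q < ?n" for p q
      using vs(3) that by (simp add: sorted_wrt_iff_nth_less)
    moreover have "vs ! p \<in> V" "vs ! q \<in> V" using vs(2) that by auto
    ultimately show ?thesis using that asym irrefl by (metis linorder_neqE_nat)
  qed
  define g where "g = (\<lambda>u. THE i. i < ?n \<and> vs ! i = u)"
  have g: "g (vs ! i) = i" if "i < ?n" for i
    unfolding g_def using that vs(1) by (auto simp: nth_eq_iff_index_eq)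
  define f where "f u = vs ! (?n - 1 - g u)" for u
  have f: "f (vs ! i) = vs ! (?n - 1 - i)" if "i < ?n" for i unfolding f_def using g that by simp
  have V: "\<exists>i<?n. u = vs ! i" if "u \<in> V" for u using that vs(2) by (metis in_set_conv_nth)
  have fV: "f u \<in> V" if u: "u \<in> V" for u
  proof -
    obtain i where "i < ?n" "u = vs ! i" using V[OF u] by blast
    then show ?thesis using f vs(2) by auto
  qed
  have ff: "f (f u) = u" if u: "u \<in> V" for u
  proof -
    obtain i where i: "i < ?n" "u = vs ! i" using V[OF u] by blast
    then have "f (f u) = vs ! (?n - 1 - (?n - 1 - i))" using f by simp
    then show ?thesis using i by simp
  qed
  have "bij_betw f V V" by (rule bij_betw_byWitness[of _ f]) (use ff fV in auto)
  moreover have "(u, v) \<in> E \<longleftrightarrow> (f v, f u) \<in> E" if u: "u \<in> V" and v: "v \<in> V" for u v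
  proof -
    obtain i where i: "i < ?n" "u = vs ! i" using V[OF u] by blast
    obtain j where j: "j < ?n" "v = vs ! j" using V[OF v] by blast
    note ij = i j
    have "(f v, f u) \<in> E \<longleftrightarrow> ?n - 1 - j < ?n - 1 - i" using ij f less by simp
    also have "\<dots> \<longleftrightarrow> i < j" using ij by linarith
    finally show ?thesis using ij less by simp
  qed
  ultimately show ?thesis unfolding selfdual_on_def by blast
qed

lemma runs_empty: "runs E V [B] \<Longrightarrow> sorted_wrt (\<lambda>u v. (u, v) \<in> E) B \<and> set B = V"
  unfolding runs_def by (simp add: sorted_wrt_map precedes_def)

end

section \<open>From twins to runs and to the abstract reduction\<close>

context twins begin

lemma obtain_runs: obtains Bs where "runs E V Bs"
proof -
  define R where "R = {(u, v). before u v}"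
  interpret R: tourn V R
  proof
    fix u v assume "u \<in> V" "v \<in> V" "u \<noteq> v"
    then show "(u, v) \<in> R \<longleftrightarrow> (v, u) \<notin> R"
      unfolding R_def before_def using total[of u v] by (cases "u \<in> In"; cases "v \<in> In") auto
  next
    fix u assume "u \<in> V"
    then show "(u, u) \<notin> R" unfolding R_def before_def using irrefl by simp
  qed (rule finite_V)
  obtain vs where vs: "distinct vs" "set vs = V" "sorted_wrt (\<lambda>u v. (u, v) \<in> R) vs"
  proof (rule R.sorted_list)
    show "\<forall>u\<in>V. \<forall>v\<in>V. \<forall>w\<in>V. (u, v) \<in> R \<longrightarrow> (v, w) \<in> R \<longrightarrow> (u, w) \<in> R"
    proof (intro ballI impI)
      fix u v w assume "u \<in> V" "v \<in> V" "w \<in> V" "(u, v) \<in> R" "(v, w) \<in> R"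
      then show "(u, w) \<in> R" using before_trans[of u v w] by (simp add: R_def)
    qed
  qed
  \<comment> \<open>With the sign recording whether a vertex lies outside \<open>In\<close>,
    \<open>precedes E\<close> is exactly the switched order \<open>R\<close>.\<close>
  define ws where "ws = map (\<lambda>v. (v, v \<notin> In)) vs"
  have "precedes E (u, u \<notin> In) (v, v \<notin> In) \<longleftrightarrow> (u, v) \<in> R" for u v
    unfolding precedes_def R_def before_def by auto
  then have "sorted_wrt (precedes E) ws" unfolding ws_def using vs(3) by (simp add: sorted_wrt_map)
  moreover have "map fst ws = vs" unfolding ws_def by (simp add: comp_def)
  moreover have "vs \<noteq> []" using vs(2) xV by auto
  ultimately obtain Bs where "runs E (fst ` set ws) Bs"
    using runs_of_word[of E ws] vs(1) by auto
  moreover have "fst ` set ws = V" using vs(2) unfolding ws_def by (simp add: image_image)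
  ultimately show thesis using that by simp
qed

text \<open>\<open>X\<close> holds the vertices deleted so far and \<open>k\<close> counts the
  deletions left out of three; at \<open>k = 0\<close> the remaining tournament is self
  dual.\<close>

definition reach :: "nat \<Rightarrow> nat list \<Rightarrow> bool" where
  "reach k zs \<longleftrightarrow> (\<exists>X Bs. X \<subseteq> V \<and> card X + k = 3 \<and> runs E (V - X) Bs \<and>
     zs = map (\<lambda>B. length B - 1) Bs)"

lemma reachI:
  assumes "X \<subseteq> V" "card X + k = 3" "runs E (V - X) Bs" "zs = map (\<lambda>B. length B - 1) Bs"
  shows "reach k zs"
  unfolding reach_def by (intro exI conjI) (rule assms)+

lemma reachE:
  assumes "reach k zs"
  obtains X Bs where "X \<subseteq> V" "card X + k = 3" "runs E (V - X) Bs" "zs = map (\<lambda>B. length B - 1) Bs"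
  using assms unfolding reach_def by (elim exE conjE) (rule that)

lemma sum_list_runs:
  assumes "runs E W Bs"
  shows "sum_list (map (\<lambda>B. length B - 1) Bs) + length Bs = card W"
proof -
  have "sum_list (map (\<lambda>B. length B - 1) Bs) + length Bs = sum_list (map length Bs)"
    if "[] \<notin> set Bs" for Bs :: "'a list list"
    using that
  proof (induction Bs)
    case (Cons B Bs)
    then have "B \<noteq> []" by auto
    then have "length B - 1 + 1 = length B" by (cases B) auto
    then show ?case using Cons by simp
  qed simp
  moreover have "[] \<notin> set Bs" using assms unfolding runs_def by blast
  ultimately have "sum_list (map (\<lambda>B. length B - 1) Bs) + length Bs = length (concat Bs)"
    by (simp add: length_concat)
  moreover have "distinct (concat Bs)" "set (concat Bs) = W" using assms unfolding runs_def by auto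
  ultimately show ?thesis using distinct_card[of "concat Bs"] by simp
qed

lemma remove_vertex:
  assumes "X \<subseteq> V" "card X + Suc k = 3" "v \<in> V - X" "runs E (V - X - {v}) Bs"
    "zs = map (\<lambda>B. length B - 1) Bs"
  shows "reach k zs"
proof (rule reachI[of "insert v X" k Bs])
  have "finite X" by (rule finite_subset[OF assms(1) finite_V])
  then show "card (insert v X) + k = 3" using assms(2,3) by simp
  have "V - X - {v} = V - insert v X" by blast
  then show "runs E (V - insert v X) Bs" using assms(4) by simp
  show "insert v X \<subseteq> V" using assms(1,3) by blast
qed (rule assms(5))

sublocale red: reduction reach "card V"
proof
  show "9 \<le> card V" by (rule card_V)
next
  fix k z zs assume "reach k (z # zs)"
  then obtain X Bs where *: "X \<subseteq> V" "card X + k = 3" "runs E (V - X) Bs"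
    "z # zs = map (\<lambda>B. length B - 1) Bs" by (rule reachE)
  then obtain B Cs where B: "Bs = B # Cs" "z = length B - 1" "zs = map (\<lambda>B. length B - 1) Cs"
    by (cases Bs) auto
  have "runs E (V - X) (Cs @ [B])" using runs_rotate[of E "V - X" "[B]" Cs] *(3) B(1) by simp
  from reachI[OF *(1,2) this] show "reach k (zs @ [z])" using B by simp
next
  fix k p x q assume "reach (Suc k) (p @ Suc x # q)"
  then obtain X Bs where *: "X \<subseteq> V" "card X + Suc k = 3" "runs E (V - X) Bs"
    "p @ Suc x # q = map (\<lambda>B. length B - 1) Bs" by (rule reachE)
  from *(4) obtain P Q B where B: "Bs = P @ B # Q" "p = map (\<lambda>B. length B - 1) P"
    "q = map (\<lambda>B. length B - 1) Q" "Suc x = length B - 1"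
    by (auto simp: append_eq_map_conv Cons_eq_map_conv)
  obtain v C where C: "B = v # C" using B(4) by (cases B) auto
  then have "length C = Suc x" using B(4) by simp
  then have "C \<noteq> []" by auto
  have r: "runs E (V - X - {v}) (P @ C # Q)"
    using runs_delete[of E "V - X" P "[]" v C Q] *(3) B(1) C \<open>C \<noteq> []\<close> by simp
  have v: "v \<in> V - X" using *(3) B(1) C unfolding runs_def by auto
  show "reach k (p @ x # q)"
    by (rule remove_vertex[OF *(1,2) v r]) (use B(2,3) \<open>length C = Suc x\<close> in simp)
next
  fix k p x y q assume "reach (Suc k) (p @ x # 0 # y # q)"
  then obtain X Bs where *: "X \<subseteq> V" "card X + Suc k = 3" "runs E (V - X) Bs"
    "p @ x # 0 # y # q = map (\<lambda>B. length B - 1) Bs" by (rule reachE)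
  from *(4) obtain P Q A M D where B: "Bs = P @ A # M # D # Q" "p = map (\<lambda>B. length B - 1) P"
    "q = map (\<lambda>B. length B - 1) Q" "x = length A - 1" "0 = length M - 1" "y = length D - 1"
    by (auto simp: append_eq_map_conv Cons_eq_map_conv)
  have ne: "A \<noteq> []" "M \<noteq> []" "D \<noteq> []" using *(3) B(1) unfolding runs_def by auto
  obtain v where v: "M = [v]" using ne(2) B(5) by (cases M) auto
  have r: "runs E (V - X - {v}) (P @ (A @ D) # Q)"
    using runs_merge[of E "V - X" P A v D Q] *(3) B(1) v by simp
  have vV: "v \<in> V - X" using *(3) B(1) v unfolding runs_def by auto
  \<comment> \<open>\<open>A\<close> and \<open>D\<close> have \<open>x + 1\<close> and
    \<open>y + 1\<close> vertices; this is where the extra 1 in \<open>kill\<close> comes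
    from.\<close>
  have "length (A @ D) - 1 = x + y + 1" using ne B(4,6) by (cases A; cases D) auto
  then show "reach k (p @ (x + y + 1) # q)"
    by (intro remove_vertex[OF *(1,2) vV r]) (simp add: B(2,3))
next
  fix k zs assume "reach k zs"
  then obtain X Bs where "runs E (V - X) Bs" "zs = map (\<lambda>B. length B - 1) Bs" by (rule reachE)
  then show "odd (length zs)" unfolding runs_def by simp
next
  fix k zs assume "reach k zs"
  then obtain X Bs where *: "X \<subseteq> V" "card X + k = 3" "runs E (V - X) Bs"
    "zs = map (\<lambda>B. length B - 1) Bs" by (rule reachE)
  have "card (V - X) = card V - card X"
    using card_Diff_subset[OF finite_subset[OF *(1) finite_V] *(1)] .
  moreover have "card X \<le> card V" using *(1) finite_V by (rule card_mono[rotated])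
  ultimately show "sum_list zs + length zs + 3 = card V + k"
    using sum_list_runs[OF *(3)] *(2,4) by simp
next
  fix zs j assume zs: "reach 0 zs" "3 \<le> length zs" "2 \<le> j" "j < sum_list zs + length zs" "even (j + card V)"
  from zs(1) obtain X Bs where **: "X \<subseteq> V" "card X + 0 = 3" "runs E (V - X) Bs"
    "zs = map (\<lambda>B. length B - 1) Bs" by (rule reachE)
  then have *: "X \<subseteq> V" "card X = 3" "runs E (V - X) Bs" "zs = map (\<lambda>B. length B - 1) Bs"
    by simp_all
  interpret W: tourn "V - X" E by (rule subtourn) blast
  have c: "card (V - X) = card V - 3"
    using card_Diff_subset[OF finite_subset[OF *(1) finite_V] *(1)] *(2) by simp
  \<comment> \<open>Deleting three vertices changes the parity of the size.\<close>
  then have "odd (card (V - X) + j)" using zs(5) card_V by presburger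
  then have "even (card {J. interval E (V - X) J \<and> card J = j})"
    using W.selfdual_even_intervals[OF selfdual[OF *(1,2)]] zs(3) by simp
  moreover have "card {J. interval E (V - X) J \<and> card J = j} = (\<Sum>z\<leftarrow>zs. z + 2 - j)"
    unfolding *(4)
  proof (rule W.card_intervals[OF *(3)])
    show "3 \<le> length Bs" using zs(2) *(4) by simp
    show "1 \<le> j" using zs(3) by simp
    show "j < card (V - X)" using zs(4) *(4) sum_list_runs[OF *(3)] by simp
  qed
  ultimately show "even (\<Sum>z\<leftarrow>zs. z + 2 - j)" by simp
qed

lemma transitive_or_three_runs:
  assumes E: "E \<subseteq> V \<times> V"
  shows "trans E \<or> (\<exists>B b c. runs E V [B, [b], [c]])"
proof -
  obtain Bs where Bs: "runs E V Bs" by (rule obtain_runs)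
  define zs where "zs = map (\<lambda>B. length B - 1) Bs"
  have r: "reach 3 zs" by (rule reachI[of "{}" 3 Bs]) (use Bs in \<open>simp_all add: zs_def\<close>)
  have "odd (length Bs)" using Bs unfolding runs_def by blast
  then have "length Bs \<noteq> 0" "length Bs \<noteq> 2" by auto
  then consider "length Bs = 1" | "3 \<le> length Bs" by linarith
  then show ?thesis
  proof cases
    case 1
    then obtain B where "Bs = [B]" by (cases Bs) auto
    then have "sorted_wrt (\<lambda>u v. (u, v) \<in> E) B" "set B = V" using runs_empty[of B] Bs by auto
    from sorted_trans[OF this E] show ?thesis by (rule disjI1)
  next
    case 2
    \<comment> \<open>For \<open>j = 2\<close> an entry \<open>z\<close> contributes exactly
      \<open>z\<close> intervals, so the interval \<open>{x, y}\<close> makes the sum of the entries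
      positive.\<close>
    have "{x, y} \<in> {J. interval E V J \<and> card J = 2}" using twin neq by simp
    moreover have "finite {J. interval E V J \<and> card J = 2}"
      using finite_V unfolding interval_def by (auto intro: finite_subset[of _ "Pow V"])
    ultimately have "card {J. interval E V J \<and> card J = 2} \<noteq> 0" by auto
    moreover have "card {J. interval E V J \<and> card J = 2} = (\<Sum>z\<leftarrow>zs. z + 2 - 2)"
      unfolding zs_def by (rule card_intervals[OF Bs 2]) (use card_V in simp_all)
    moreover have "map (\<lambda>z. z + 2 - 2) zs = zs" by simp
    ultimately have "0 < sum_list zs" by (metis gr0I)
    then obtain k where "reach 3 [k, 0, 0]"
      using red.final_shape[OF r] 2 unfolding zs_def by auto
    then obtain X Cs where X: "X \<subseteq> V" "card X + 3 = 3" "runs E (V - X) Cs"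
      "[k, 0, 0] = map (\<lambda>B. length B - 1) Cs" by (rule reachE)
    have "X = {}" using finite_subset[OF X(1) finite_V] X(2) by simp
    moreover obtain B M N where "Cs = [B, M, N]" "length M - 1 = 0" "length N - 1 = 0"
      using X(4) by auto
    ultimately have C: "runs E V [B, M, N]" "length M - 1 = 0" "length N - 1 = 0" using X(3) by simp_all
    then have "M \<noteq> []" "N \<noteq> []" unfolding runs_def by auto
    then obtain b c where "M = [b]" "N = [c]" using C(2,3) by (cases M; cases N) auto
    then have "runs E V [B, [b], [c]]" using C(1) by simp
    then have "\<exists>B b c. runs E V [B, [b], [c]]" by (intro exI)
    then show ?thesis by (rule disjI2)
  qed
qed

end

section \<open>The characterization\<close>

text \<open>The signs of the three runs alternate, so \<open>b\<close> dominates \<open>B\<close>,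
  every vertex of \<open>B\<close> dominates \<open>c\<close>, and \<open>c\<close> dominates
  \<open>b\<close>. Reversing this last arc gives the linear order \<open>b\<close>,
  \<open>B\<close>, \<open>c\<close>.\<close>

lemma almost_transitiveI:
  assumes T: "tournament T" and r: "runs (parcs T) (pverts T) [B, [b], [c]]" and 3: "3 \<le> card (pverts T)"
  shows "almost_transitive T"
proof -
  let ?V = "pverts T" and ?E = "parcs T"
  interpret tourn ?V ?E by (rule tournament_tourn[OF T])
  have E: "?E \<subseteq> ?V \<times> ?V" by (rule tournament_arcs[OF T])
  define F where "F = insert (b, c) (?E - {(c, b)})"
  define L where "L = \<lparr>pverts = ?V, parcs = F\<rparr>"
  have V: "set B \<union> {b, c} = ?V" and d: "distinct (B @ [b, c])"
    using r unfolding runs_def by auto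
  have arcs: "sorted_wrt (\<lambda>u v. (u, v) \<in> ?E) B" "\<forall>u\<in>set B. (b, u) \<in> ?E \<and> (u, c) \<in> ?E" "(c, b) \<in> ?E"
    using r unfolding runs_def by (auto simp: sorted_wrt_append sorted_wrt_map precedes_def)
  have bc: "b \<in> ?V" "c \<in> ?V" "b \<noteq> c" "b \<notin> set B" "c \<notin> set B" using V d by auto
  have nbc: "(b, c) \<notin> ?E" using asym arcs(3) bc by blast
  have tL: "tourn ?V F"
  proof
    fix u v assume "u \<in> ?V" "v \<in> ?V" "u \<noteq> v"
    then show "(u, v) \<in> F \<longleftrightarrow> (v, u) \<notin> F" unfolding F_def using total[of u v] arcs(3) nbc bc by (cases "(u, v) = (b, c)"; cases "(u, v) = (c, b)") auto
  qed (use finite_V irrefl bc in \<open>auto simp: F_def\<close>)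
  then interpret L: tourn ?V F .
  have FV: "F \<subseteq> ?V \<times> ?V" unfolding F_def using E bc by auto
  have L: "tournament L" by (rule tournamentI) (use tL FV in \<open>auto simp: L_def\<close>)
  have "sorted_wrt (\<lambda>u v. (u, v) \<in> F) B"
    by (rule sorted_wrt_mono_rel[OF _ arcs(1)]) (use bc in \<open>auto simp: F_def\<close>)
  then have s: "sorted_wrt (\<lambda>u v. (u, v) \<in> F) (b # B @ [c])"
    using arcs(2) bc by (auto simp: sorted_wrt_append F_def)
  have "trans F" by (rule L.sorted_trans[OF s _ FV]) (use V in auto)
  then have trans: "transitive L" by (simp add: L_def transitive_def)
  have min: "\<forall>x\<in>pverts L - {b}. (b, x) \<in> parcs L"
  proof
    fix x assume "x \<in> pverts L - {b}"
    then have "x \<in> set (B @ [c])" unfolding L_def using V by auto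
    then show "(b, x) \<in> parcs L" unfolding L_def using s by auto
  qed
  have max: "\<forall>x\<in>pverts L - {c}. (x, c) \<in> parcs L"
  proof
    fix x assume "x \<in> pverts L - {c}"
    then have "x \<in> set (b # B)" unfolding L_def using V by auto
    moreover have "sorted_wrt (\<lambda>u v. (u, v) \<in> F) ((b # B) @ [c])" using s by simp
    ultimately show "(x, c) \<in> parcs L" unfolding L_def sorted_wrt_append by auto
  qed
  have "insert (c, b) (F - {(b, c)}) = ?E" unfolding F_def using arcs(3) nbc by auto
  then have T': "T = reverse_arc (b, c) L" unfolding reverse_arc_def L_def by simp
  have "3 \<le> card (pverts L)" "b \<in> pverts L" "c \<in> pverts L" unfolding L_def using 3 bc by simp_all
  then show ?thesis
    unfolding almost_transitive_def
    by (intro exI[of _ L] exI[of _ b] exI[of _ c] conjI L trans min max T')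
qed

lemma transitive_selfdual_on:
  assumes T: "tournament T" and t: "transitive T" and W: "W \<subseteq> pverts T"
  shows "selfdual_on (parcs T) W"
proof -
  interpret tourn W "parcs T" using tourn.subtourn[OF tournament_tourn[OF T] W] .
  show ?thesis using t unfolding transitive_def by (intro reversal ballI impI) (rule transD)
qed

text \<open>The order reversal of the linear order exchanges its two ends, hence it also reverses the
  arc between them.\<close>

lemma almost_transitive_selfdual_on:
  assumes T: "almost_transitive T" and W: "W \<subseteq> pverts T"
  shows "selfdual_on (parcs T) W"
proof -
  obtain L a b where L: "tournament L" "transitive L" "3 \<le> card (pverts L)"
    and a: "a \<in> pverts L" "\<forall>x\<in>pverts L - {a}. (a, x) \<in> parcs L"
    and b: "b \<in> pverts L" "\<forall>x\<in>pverts L - {b}. (x, b) \<in> parcs L"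
    and T: "T = reverse_arc (a, b) L"
    using T unfolding almost_transitive_def by (elim exE conjE) (rule that)
  interpret V: tourn "pverts L" "parcs L" by (rule tournament_tourn[OF L(1)])
  have WV: "W \<subseteq> pverts L" using W T by (simp add: reverse_arc_def)
  have E: "parcs T = insert (b, a) (parcs L - {(a, b)})" using T by (simp add: reverse_arc_def)
  obtain f where bij: "bij_betw f W W"
    and f: "\<And>u v. u \<in> W \<Longrightarrow> v \<in> W \<Longrightarrow> (u, v) \<in> parcs L \<longleftrightarrow> (f v, f u) \<in> parcs L"
    using transitive_selfdual_on[OF L(1,2) WV] unfolding selfdual_on_def by auto
  have inj: "inj_on f W" and im: "f ` W = W" using bij by (auto simp: bij_betw_def)
  have fW: "f u \<in> W" if "u \<in> W" for u using im imageI[OF that, of f] by simp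
  have ends: "f a = b \<and> f b = a" if ab: "a \<in> W" "b \<in> W"
  proof
    show "f a = b"
    proof (rule ccontr)
      assume "f a \<noteq> b"
      then have 1: "(f a, b) \<in> parcs L" using b(2) fW[OF ab(1)] WV by auto
      obtain u where u: "u \<in> W" "b = f u" using im ab by blast
      then have "(u, a) \<in> parcs L" using f[of u a] 1 ab by simp
      moreover have "u \<noteq> a" using u \<open>f a \<noteq> b\<close> by blast
      then have "(a, u) \<in> parcs L" using a(2) u(1) WV by auto
      ultimately show False using V.asym[of u a] u WV a(1) by auto
    qed
    show "f b = a"
    proof (rule ccontr)
      assume "f b \<noteq> a"
      then have 1: "(a, f b) \<in> parcs L" using a(2) fW[OF ab(2)] WV by auto
      obtain u where u: "u \<in> W" "a = f u" using im ab by blast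
      then have "(b, u) \<in> parcs L" using f[of b u] 1 ab by simp
      moreover have "u \<noteq> b" using u \<open>f b \<noteq> a\<close> by blast
      then have "(u, b) \<in> parcs L" using b(2) u(1) WV by auto
      ultimately show False using V.asym[of u b] u WV b(1) by auto
    qed
  qed
  have "(u, v) \<in> parcs T \<longleftrightarrow> (f v, f u) \<in> parcs T" if uv: "u \<in> W" "v \<in> W" for u v
  proof (cases "a \<in> W \<and> b \<in> W")
    case True
    then have "f w = b \<longleftrightarrow> w = a" "f w = a \<longleftrightarrow> w = b" if "w \<in> W" for w
      using ends inj_on_eq_iff[OF inj, of w a] inj_on_eq_iff[OF inj, of w b] that by auto
    then have "f v = b \<longleftrightarrow> v = a" "f u = b \<longleftrightarrow> u = a" "f v = a \<longleftrightarrow> v = b" "f u = a \<longleftrightarrow> u = b"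
      using uv by simp_all
    then show ?thesis unfolding E using f[OF uv] by simp blast
  next
    \<comment> \<open>If an end is missing from \<open>W\<close>, the arc between the ends does not
      occur on \<open>W\<close>, where \<open>T\<close> and \<open>L\<close> then agree.\<close>
    case False
    have "(u, v) \<noteq> (a, b)" "(u, v) \<noteq> (b, a)" "(f v, f u) \<noteq> (a, b)" "(f v, f u) \<noteq> (b, a)"
      using False uv fW[OF uv(1)] fW[OF uv(2)] by auto
    then show ?thesis unfolding E using f[OF uv] by auto
  qed
  then show ?thesis unfolding selfdual_on_def using bij by (intro exI[of _ f] conjI ballI)
qed

theorem theorem4:
  fixes T :: "'a pair_pre_digraph"
  assumes "tournament T"
    and "decomposable T"
    and "card (pverts T) \<ge> 9"
  shows "minus_self_dual 3 T \<longleftrightarrow> transitive T \<or> almost_transitive T"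
proof
  let ?V = "pverts T" and ?E = "parcs T"
  interpret tourn ?V ?E by (rule tournament_tourn[OF assms(1)])
  {
    assume sd: "minus_self_dual 3 T"
    have "selfdual_on ?E (?V - X)" if "X \<subseteq> ?V" "card X = 3" for X
    proof -
      have "?V - X \<subseteq> ?V" by blast
      from self_dual_induced[OF this] sd that show ?thesis unfolding minus_self_dual_def by simp
    qed
    then interpret minus3 ?V ?E using assms(3) by unfold_locales
    obtain I where I: "interval_of T I" "\<not> trivial_interval T I"
      using assms(2) unfolding indecomposable_def by blast
    then have I': "interval ?E ?V I" "I \<noteq> ?V" "I \<noteq> {}"
      unfolding interval_of_def interval_def trivial_interval_def by auto
    then obtain p where p: "p \<in> I" by blast
    moreover have "I \<noteq> {p}" using I p unfolding interval_of_def trivial_interval_def by auto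
    ultimately obtain q where q: "q \<in> I" "p \<noteq> q" by blast
    obtain x y where "x \<in> ?V" "y \<in> ?V" "(x, y) \<in> ?E" "interval ?E ?V {x, y}"
      using twins_exist[OF I'(1,2) p q] by blast
    then interpret twins ?V ?E x y by unfold_locales
    show "transitive T \<or> almost_transitive T"
      using transitive_or_three_runs[OF tournament_arcs[OF assms(1)]]
    proof
      assume "trans ?E"
      then show ?thesis unfolding transitive_def by simp
    next
      assume "\<exists>B b c. runs ?E ?V [B, [b], [c]]"
      then obtain B b c where "runs ?E ?V [B, [b], [c]]" by blast
      from almost_transitiveI[OF assms(1) this] show ?thesis using assms(3) by simp
    qed
  }
  {
    assume "transitive T \<or> almost_transitive T"
    then have sd: "selfdual_on ?E W" if "W \<subseteq> ?V" for W
      using transitive_selfdual_on[OF assms(1) _ that] almost_transitive_selfdual_on[OF _ that] by blast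
    show "minus_self_dual 3 T"
      unfolding minus_self_dual_def
    proof (intro allI impI)
      fix X
      have "?V - X \<subseteq> ?V" by blast
      from sd[OF this] self_dual_induced[OF this] show "self_dual (induced T (?V - X))" by simp
    qed
  }
qed

end
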